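(* For every $1<p<\infty$, the space $\mathbb{L}(L_p[0,1])$ has the Ball Covering Property.
   Context: $L_p[0,1]$ is the real Lebesgue space and $\mathbb{L}(L_p[0,1])$ is the space of bounded linear operators from $L_p[0,1]$ to itself with the operator norm. A normed space $\mathbb{Z}$ has the Ball Covering Property if there are $z_n\in\mathbb{Z}\setminus\{0\}$ and $0<r_n\le\|z_n\|$ ($n\in\mathbb{N}$) such that the unit sphere of $\mathbb{Z}$ is contained in $\bigcup_n B(z_n,r_n)$, where $B(z,r)$ is the open ball of center $z$ and radius $r$. *)

theory Defs
  imports "HOL-Analysis.Analysis" "HOL-Library.Function_Algebras"
begin

section \<open>Normed spaces with explicit carrier\<close>

text \<open>
  The exponent \<open>p\<close> is a real variable, so neither \<open>L\<^sub>p\<close> nor its operator space can be an instance of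
  the type class \<^class>\<open>real_normed_vector\<close>.  A normed space is therefore a pair of a linear subspace
  \<open>V\<close> of some real vector space and a norm \<open>N\<close>, of which only the values on \<open>V\<close> matter.
\<close>

definition normed_space_on :: "'a::real_vector set \<Rightarrow> ('a \<Rightarrow> real) \<Rightarrow> bool" where
  "normed_space_on V N \<longleftrightarrow> subspace V \<and>
     (\<forall>x\<in>V. 0 \<le> N x \<and> (N x = 0 \<longleftrightarrow> x = 0)) \<and>
     (\<forall>c. \<forall>x\<in>V. N (c *\<^sub>R x) = \<bar>c\<bar> * N x) \<and>
     (\<forall>x\<in>V. \<forall>y\<in>V. N (x + y) \<le> N x + N y)"

definition open_ball_on :: "'a::real_vector set \<Rightarrow> ('a \<Rightarrow> real) \<Rightarrow> 'a \<Rightarrow> real \<Rightarrow> 'a set" where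
  "open_ball_on V N z r = {x \<in> V. N (x - z) < r}"

definition unit_sphere_on :: "'a::real_vector set \<Rightarrow> ('a \<Rightarrow> real) \<Rightarrow> 'a set" where
  "unit_sphere_on V N = {x \<in> V. N x = 1}"

definition ball_covering_property :: "'a::real_vector set \<Rightarrow> ('a \<Rightarrow> real) \<Rightarrow> bool" where
  "ball_covering_property V N \<longleftrightarrow>
     (\<exists>(z :: nat \<Rightarrow> 'a) (r :: nat \<Rightarrow> real).
        (\<forall>n. z n \<in> V - {0} \<and> 0 < r n \<and> r n \<le> N (z n)) \<and>
        unit_sphere_on V N \<subseteq> (\<Union>n. open_ball_on V N (z n) (r n)))"

section \<open>Bounded linear operators\<close>

instantiation "fun" :: (type, real_vector) real_vector
begin

definition "c *\<^sub>R f = (\<lambda>x. c *\<^sub>R f x)"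

instance
  by standard (auto simp: scaleR_fun_def fun_eq_iff algebra_simps)

end

text \<open>
  An operator \<open>V \<rightarrow> W\<close> is represented by its extension by \<open>0\<close> outside \<open>V\<close>, so that two operators are
  equal as HOL functions iff they agree on \<open>V\<close>, and the pointwise vector space operations apply.
\<close>

definition bounded_operators ::
  "'a::real_vector set \<Rightarrow> ('a \<Rightarrow> real) \<Rightarrow> 'b::real_vector set \<Rightarrow> ('b \<Rightarrow> real) \<Rightarrow> ('a \<Rightarrow> 'b) set" where
  "bounded_operators V N W M = {T.
     (\<forall>x\<in>V. T x \<in> W) \<and>
     (\<forall>x\<in>V. \<forall>y\<in>V. T (x + y) = T x + T y) \<and>
     (\<forall>c. \<forall>x\<in>V. T (c *\<^sub>R x) = c *\<^sub>R T x) \<and>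
     (\<exists>C. \<forall>x\<in>V. M (T x) \<le> C * N x) \<and>
     (\<forall>x. x \<notin> V \<longrightarrow> T x = 0)}"

definition operator_norm ::
  "'a::real_vector set \<Rightarrow> ('a \<Rightarrow> real) \<Rightarrow> ('b::real_vector \<Rightarrow> real) \<Rightarrow> ('a \<Rightarrow> 'b) \<Rightarrow> real" where
  "operator_norm V N M T = (SUP x\<in>{x \<in> V. N x \<le> 1}. M (T x))"

lemma normed_space_on_bounded_operators:
  assumes V: "normed_space_on V N" and W: "normed_space_on W M"
  shows "normed_space_on (bounded_operators V N W M) (operator_norm V N M)"
proof -
  let ?B = "bounded_operators V N W M" and ?U = "{x \<in> V. N x \<le> 1}"
  have sV: "subspace V" and sW: "subspace W"
    using V W by (auto simp: normed_space_on_def)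
  have V0: "0 \<in> ?U" using V subspace_0[OF sV] by (auto simp: normed_space_on_def)
  have Nn: "0 \<le> N x" if "x \<in> V" for x using V that by (auto simp: normed_space_on_def)
  have N0: "N x = 0 \<longleftrightarrow> x = 0" if "x \<in> V" for x using V that by (auto simp: normed_space_on_def)
  have Ns: "N (c *\<^sub>R x) = \<bar>c\<bar> * N x" if "x \<in> V" for c x
    using V that by (auto simp: normed_space_on_def)
  have Mn: "0 \<le> M x" if "x \<in> W" for x using W that by (auto simp: normed_space_on_def)
  have M0: "M x = 0 \<longleftrightarrow> x = 0" if "x \<in> W" for x using W that by (auto simp: normed_space_on_def)
  have Ms: "M (c *\<^sub>R x) = \<bar>c\<bar> * M x" if "x \<in> W" for c x
    using W that by (auto simp: normed_space_on_def)
  have Mt: "M (x + y) \<le> M x + M y" if "x \<in> W" "y \<in> W" for x y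
    using W that by (auto simp: normed_space_on_def)
  have TW: "T x \<in> W" if "T \<in> ?B" "x \<in> V" for T x
    using that by (auto simp: bounded_operators_def)
  have bdd: "bdd_above ((\<lambda>x. M (T x)) ` ?U)" if "T \<in> ?B" for T
  proof -
    from that obtain C where C: "\<And>x. x \<in> V \<Longrightarrow> M (T x) \<le> C * N x"
      unfolding bounded_operators_def by blast
    have "M (T x) \<le> \<bar>C\<bar>" if "x \<in> ?U" for x
    proof -
      have "M (T x) \<le> C * N x" using C that by auto
      also have "\<dots> \<le> \<bar>C\<bar> * N x" using Nn that by (intro mult_right_mono) auto
      also have "\<dots> \<le> \<bar>C\<bar> * 1" using that by (intro mult_left_mono) auto
      finally show ?thesis by simp
    qed
    then show ?thesis by (auto simp: bdd_above_def)
  qed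
  have ub: "M (T x) \<le> operator_norm V N M T" if "T \<in> ?B" "x \<in> ?U" for T x
    unfolding operator_norm_def by (rule cSUP_upper[OF that(2) bdd[OF that(1)]])
  have least: "operator_norm V N M T \<le> K" if "\<And>x. x \<in> ?U \<Longrightarrow> M (T x) \<le> K" for T K
    unfolding operator_norm_def using V0 that by (intro cSUP_least) auto
  have nonneg: "0 \<le> operator_norm V N M T" if "T \<in> ?B" for T
    using Mn[OF TW[OF that]] ub[OF that V0] V0 by fastforce
  have add: "S + T \<in> ?B" if S: "S \<in> ?B" and T: "T \<in> ?B" for S T
  proof -
    from S obtain C where C: "\<And>x. x \<in> V \<Longrightarrow> M (S x) \<le> C * N x"
      unfolding bounded_operators_def by blast
    from T obtain D where D: "\<And>x. x \<in> V \<Longrightarrow> M (T x) \<le> D * N x"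
      unfolding bounded_operators_def by blast
    have "M ((S + T) x) \<le> (C + D) * N x" if "x \<in> V" for x
      using Mt[OF TW[OF S that] TW[OF T that]] C[OF that] D[OF that] by (simp add: algebra_simps)
    then show ?thesis
      using S T sW unfolding bounded_operators_def
      by (auto simp: subspace_add scaleR_add_right)
  qed
  have scale: "c *\<^sub>R T \<in> ?B" if T: "T \<in> ?B" for c T
  proof -
    from T obtain C where C: "\<And>x. x \<in> V \<Longrightarrow> M (T x) \<le> C * N x"
      unfolding bounded_operators_def by blast
    have "M ((c *\<^sub>R T) x) \<le> (\<bar>c\<bar> * C) * N x" if "x \<in> V" for x
      using mult_left_mono[OF C[OF that], of "\<bar>c\<bar>"] Ms[OF TW[OF T that]]
      by (simp add: scaleR_fun_def mult.assoc)
    then show ?thesis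
      using T sW unfolding bounded_operators_def
      by (auto simp: subspace_scale scaleR_add_right scaleR_fun_def)
  qed
  have zero: "0 \<in> ?B"
    using subspace_0[OF sW] M0[of 0] by (auto simp: bounded_operators_def intro!: exI[of _ 0])
  have scale_le: "operator_norm V N M (c *\<^sub>R T) \<le> \<bar>c\<bar> * operator_norm V N M T"
    if T: "T \<in> ?B" for c T
  proof (rule least)
    fix x assume x: "x \<in> ?U"
    then have "M ((c *\<^sub>R T) x) = \<bar>c\<bar> * M (T x)"
      using Ms[OF TW[OF T]] by (simp add: scaleR_fun_def)
    then show "M ((c *\<^sub>R T) x) \<le> \<bar>c\<bar> * operator_norm V N M T"
      using ub[OF T x] by (simp add: mult_left_mono)
  qed
  have scale_eq: "operator_norm V N M (c *\<^sub>R T) = \<bar>c\<bar> * operator_norm V N M T"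
    if T: "T \<in> ?B" for c T
  proof (cases "c = 0")
    case True
    have "operator_norm V N M (c *\<^sub>R T) \<le> 0" using scale_le[OF T, of c] True by simp
    then show ?thesis using nonneg[OF scale[OF T, of c]] True by simp
  next
    case False
    have "operator_norm V N M T \<le> \<bar>inverse c\<bar> * operator_norm V N M (c *\<^sub>R T)"
      using scale_le[OF scale[OF T, of c], of "inverse c"] False by simp
    then have "\<bar>c\<bar> * operator_norm V N M T \<le> operator_norm V N M (c *\<^sub>R T)"
      using False by (simp add: field_simps abs_inverse)
    then show ?thesis using scale_le[OF T, of c] by simp
  qed
  have definite: "operator_norm V N M T = 0 \<longleftrightarrow> T = 0" if T: "T \<in> ?B" for T
  proof
    assume "T = 0"
    then have "operator_norm V N M T \<le> 0"
      using M0[OF subspace_0[OF sW]] by (intro least) auto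
    then show "operator_norm V N M T = 0" using nonneg[OF T] by simp
  next
    assume z: "operator_norm V N M T = 0"
    have "T x = 0" for x
    proof (cases "x \<in> V \<and> x \<noteq> 0")
      case True
      let ?c = "inverse (N x)"
      have pos: "0 < N x" using True Nn[of x] N0[of x] by force
      have "?c *\<^sub>R x \<in> ?U" using True pos Ns[of x ?c] sV by (auto simp: subspace_scale)
      then have "M (T (?c *\<^sub>R x)) = 0"
        using ub[OF T, of "?c *\<^sub>R x"] Mn[OF TW[OF T, of "?c *\<^sub>R x"]] z by auto
      then have "T (?c *\<^sub>R x) = 0"
        using M0[OF TW[OF T, of "?c *\<^sub>R x"]] True sV by (auto simp: subspace_scale)
      moreover have "T (?c *\<^sub>R x) = ?c *\<^sub>R T x" using T True by (auto simp: bounded_operators_def)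
      ultimately show ?thesis using pos by simp
    next
      case False
      have "T (0 *\<^sub>R 0) = 0 *\<^sub>R T 0"
        using T subspace_0[OF sV] unfolding bounded_operators_def by blast
      with False T show ?thesis by (auto simp: bounded_operators_def)
    qed
    then show "T = 0" by (simp add: fun_eq_iff)
  qed
  have triangle: "operator_norm V N M (S + T) \<le> operator_norm V N M S + operator_norm V N M T"
    if S: "S \<in> ?B" and T: "T \<in> ?B" for S T
  proof (rule least)
    fix x assume x: "x \<in> ?U"
    then have "M ((S + T) x) \<le> M (S x) + M (T x)"
      using Mt[OF TW[OF S] TW[OF T]] by simp
    also have "\<dots> \<le> operator_norm V N M S + operator_norm V N M T"
      using ub[OF S x] ub[OF T x] by simp
    finally show "M ((S + T) x) \<le> operator_norm V N M S + operator_norm V N M T" .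
  qed
  show ?thesis
    unfolding normed_space_on_def subspace_def
    using zero add scale nonneg definite scale_eq triangle by blast
qed

section \<open>The Lebesgue spaces on the unit interval\<close>

abbreviation lebesgue01 :: "real measure" where
  "lebesgue01 \<equiv> lebesgue_on {0..1}"

text \<open>Measurable functions on the unit interval modulo equality almost everywhere; the values of a
  representative outside the unit interval are irrelevant.\<close>

definition ae_eq01 :: "(real \<Rightarrow> real) \<Rightarrow> (real \<Rightarrow> real) \<Rightarrow> bool" where
  "ae_eq01 f g \<longleftrightarrow> f \<in> borel_measurable lebesgue01 \<and> g \<in> borel_measurable lebesgue01 \<and>
     (AE t in lebesgue01. f t = g t)"

quotient_type l0 = "real \<Rightarrow> real" / partial: ae_eq01
proof (rule part_equivpI)
  show "\<exists>f. ae_eq01 f f" by (rule exI[of _ "\<lambda>_. 0"]) (simp add: ae_eq01_def)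
  show "symp ae_eq01"
    by (rule sympI) (auto simp: ae_eq01_def eq_commute)
  show "transp ae_eq01"
  proof (rule transpI)
    fix f g h assume fg: "ae_eq01 f g" and gh: "ae_eq01 g h"
    have "AE t in lebesgue01. f t = g t" "AE t in lebesgue01. g t = h t"
      using fg gh by (simp_all add: ae_eq01_def)
    then have "AE t in lebesgue01. f t = h t" by eventually_elim simp
    then show "ae_eq01 f h" using fg gh by (simp add: ae_eq01_def)
  qed
qed

instantiation l0 :: real_vector
begin

lift_definition zero_l0 :: l0 is "\<lambda>_. 0" by (simp add: ae_eq01_def)

lift_definition plus_l0 :: "l0 \<Rightarrow> l0 \<Rightarrow> l0" is "\<lambda>f g t. f t + g t"
  unfolding ae_eq01_def by (auto elim!: eventually_elim2)

lift_definition minus_l0 :: "l0 \<Rightarrow> l0 \<Rightarrow> l0" is "\<lambda>f g t. f t - g t"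
  unfolding ae_eq01_def by (auto elim!: eventually_elim2)

lift_definition uminus_l0 :: "l0 \<Rightarrow> l0" is "\<lambda>f t. - f t"
  unfolding ae_eq01_def by auto

lift_definition scaleR_l0 :: "real \<Rightarrow> l0 \<Rightarrow> l0" is "\<lambda>c f t. c * f t"
  unfolding ae_eq01_def by (auto elim!: eventually_mono)

instance
  by standard (transfer; auto simp: ae_eq01_def algebra_simps)+

end

lift_definition in_Lp :: "real \<Rightarrow> l0 \<Rightarrow> bool" is
  "\<lambda>p f. integrable lebesgue01 (\<lambda>t. \<bar>f t\<bar> powr p)"
  unfolding ae_eq01_def by (intro integrable_cong_AE) (auto elim!: eventually_mono)

definition Lp :: "real \<Rightarrow> l0 set" where
  "Lp p = {f. in_Lp p f}"

lift_definition Lp_norm :: "real \<Rightarrow> l0 \<Rightarrow> real" is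
  "\<lambda>p f. (\<integral>t. \<bar>f t\<bar> powr p \<partial>lebesgue01) powr (1 / p)"
  unfolding ae_eq01_def
  by (intro arg_cong[where f = "\<lambda>x. x powr _"] integral_cong_AE) (auto elim!: eventually_mono)

lemma powr_convex_nonneg:
  fixes u v c d p :: real
  assumes p: "1 \<le> p" and "0 \<le> u" "0 \<le> v" and c: "0 < c" and d: "0 < d" and s: "c + d = 1"
  shows "(c * u + d * v) powr p \<le> c * u powr p + d * v powr p"
proof -
  have shrink: "(e * w) powr p \<le> e * w powr p" if "0 < e" "e \<le> 1" "0 \<le> w" for e w :: real
  proof -
    have "e powr p \<le> e powr 1" using p that by (intro powr_mono') auto
    then show ?thesis using that by (simp add: powr_mult mult_right_mono)
  qed
  consider "u = 0" | "v = 0" | "0 < u" "0 < v" using assms by linarith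
  then show ?thesis
  proof cases
    case 1
    then show ?thesis using shrink[of d v] assms by simp
  next
    case 2
    then show ?thesis using shrink[of c u] assms by simp
  next
    case 3
    have "c = 1 - d" using s by simp
    then show ?thesis using convex_onD[OF powr_convex[OF p], of d u v] 3 c d by simp
  qed
qed

lemma Minkowski_real:
  fixes a b x y p :: real
  assumes p: "1 \<le> p" and a: "0 < a" and b: "0 < b"
  shows "\<bar>x + y\<bar> powr p \<le> (a + b) powr p *
    (a / (a + b) * (\<bar>x\<bar> powr p / a powr p) + b / (a + b) * (\<bar>y\<bar> powr p / b powr p))"
proof -
  let ?u = "\<bar>x\<bar> / a" and ?v = "\<bar>y\<bar> / b"
  have s: "a / (a + b) + b / (a + b) = 1" using a b by (simp add: add_divide_distrib[symmetric])
  have "\<bar>x + y\<bar> powr p \<le> (\<bar>x\<bar> + \<bar>y\<bar>) powr p"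
    using p by (intro powr_mono2) auto
  also have "\<bar>x\<bar> + \<bar>y\<bar> = (a + b) * (a / (a + b) * ?u + b / (a + b) * ?v)"
  proof -
    have "a + b \<noteq> 0" using a b by simp
    then show ?thesis using a b by (simp add: distrib_left)
  qed
  also have "\<dots> powr p = (a + b) powr p * (a / (a + b) * ?u + b / (a + b) * ?v) powr p"
    using a b by (intro powr_mult)
  also have "\<dots> \<le> (a + b) powr p * (a / (a + b) * ?u powr p + b / (a + b) * ?v powr p)"
    using a b s
    by (intro mult_left_mono powr_convex_nonneg[OF p]) auto
  finally show ?thesis using a b by (simp add: powr_divide)
qed

lemma normed_space_on_Lp:
  assumes p: "1 \<le> p"
  shows "normed_space_on (Lp p) (Lp_norm p)"
proof -
  have add: "in_Lp p (f + g)" if "in_Lp p f" "in_Lp p g" for f g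
    using that
  proof (transfer fixing: p)
    fix f g
    assume m: "ae_eq01 f f" "ae_eq01 g g"
      and i: "integrable lebesgue01 (\<lambda>t. \<bar>f t\<bar> powr p)" "integrable lebesgue01 (\<lambda>t. \<bar>g t\<bar> powr p)"
    show "integrable lebesgue01 (\<lambda>t. \<bar>f t + g t\<bar> powr p)"
    proof (rule Bochner_Integration.integrable_bound)
      show "integrable lebesgue01
        (\<lambda>t. (1 + 1) powr p * (1 / (1 + 1) * (\<bar>f t\<bar> powr p / 1 powr p) + 1 / (1 + 1) * (\<bar>g t\<bar> powr p / 1 powr p)))"
        using i by (intro integrable_mult_right Bochner_Integration.integrable_add integrable_divide)
      show "(\<lambda>t. \<bar>f t + g t\<bar> powr p) \<in> borel_measurable lebesgue01"
        using m by (auto simp: ae_eq01_def)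
      show "AE t in lebesgue01. norm (\<bar>f t + g t\<bar> powr p) \<le> norm ((1 + 1) powr p *
          (1 / (1 + 1) * (\<bar>f t\<bar> powr p / 1 powr p) + 1 / (1 + 1) * (\<bar>g t\<bar> powr p / 1 powr p)))"
      proof (rule AE_I2)
        fix t
        show "norm (\<bar>f t + g t\<bar> powr p) \<le> norm ((1 + 1) powr p *
          (1 / (1 + 1) * (\<bar>f t\<bar> powr p / 1 powr p) + 1 / (1 + 1) * (\<bar>g t\<bar> powr p / 1 powr p)))"
          using Minkowski_real[OF p, of 1 1 "f t" "g t"] by simp
      qed
    qed
  qed
  have scale: "in_Lp p (c *\<^sub>R f)" if "in_Lp p f" for c f
    using that by (transfer fixing: p) (simp add: abs_mult powr_mult)
  have zero: "in_Lp p 0"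
    using p by (transfer fixing: p) simp
  have nonneg: "0 \<le> Lp_norm p f" for f
    by (transfer fixing: p) simp
  have definite: "Lp_norm p f = 0 \<longleftrightarrow> f = 0" if "in_Lp p f" for f
    using that
  proof (transfer fixing: p)
    fix f
    assume m: "ae_eq01 f f" and i: "integrable lebesgue01 (\<lambda>t. \<bar>f t\<bar> powr p)"
    have "(\<integral>t. \<bar>f t\<bar> powr p \<partial>lebesgue01) = 0 \<longleftrightarrow> (AE t in lebesgue01. \<bar>f t\<bar> powr p = 0)"
      by (rule integral_nonneg_eq_0_iff_AE[OF i]) simp
    then show "(\<integral>t. \<bar>f t\<bar> powr p \<partial>lebesgue01) powr (1 / p) = 0 \<longleftrightarrow> ae_eq01 f (\<lambda>_. 0)"
      using m by (simp add: ae_eq01_def)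
  qed
  have scale_eq: "Lp_norm p (c *\<^sub>R f) = \<bar>c\<bar> * Lp_norm p f" for c f
    using p by (transfer fixing: p) (simp add: abs_mult powr_mult powr_powr)
  have power: "(\<integral>t. \<bar>f t\<bar> powr p \<partial>lebesgue01) = a powr p"
    if "(\<integral>t. \<bar>f t\<bar> powr p \<partial>lebesgue01) powr (1 / p) = a" for f a
  proof -
    have "0 \<le> (\<integral>t. \<bar>f t\<bar> powr p \<partial>lebesgue01)" by (rule Bochner_Integration.integral_nonneg) simp
    then show ?thesis using p that[symmetric] by (simp add: powr_powr)
  qed
  have pos: "Lp_norm p (f + g) \<le> a + b"
    if "in_Lp p f" "in_Lp p g" "Lp_norm p f = a" "Lp_norm p g = b" "0 < a" "0 < b" "in_Lp p (f + g)"
    for f g a b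
    using that
  proof (transfer fixing: p a b)
    fix f g
    assume m: "ae_eq01 f f" "ae_eq01 g g"
      and i: "integrable lebesgue01 (\<lambda>t. \<bar>f t\<bar> powr p)" "integrable lebesgue01 (\<lambda>t. \<bar>g t\<bar> powr p)"
      and n: "(\<integral>t. \<bar>f t\<bar> powr p \<partial>lebesgue01) powr (1 / p) = a"
        "(\<integral>t. \<bar>g t\<bar> powr p \<partial>lebesgue01) powr (1 / p) = b"
      and ab: "0 < a" "0 < b"
      and s: "integrable lebesgue01 (\<lambda>t. \<bar>f t + g t\<bar> powr p)"
    have "(\<integral>t. \<bar>f t + g t\<bar> powr p \<partial>lebesgue01) \<le> (\<integral>t. (a + b) powr p *
        (a / (a + b) * (\<bar>f t\<bar> powr p / a powr p) + b / (a + b) * (\<bar>g t\<bar> powr p / b powr p)) \<partial>lebesgue01)"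
      using i s Minkowski_real[OF p ab]
      by (intro integral_mono integrable_mult_right Bochner_Integration.integrable_add integrable_divide)
    also have "\<dots> = (a + b) powr p *
        (a / (a + b) * ((\<integral>t. \<bar>f t\<bar> powr p \<partial>lebesgue01) / a powr p) +
         b / (a + b) * ((\<integral>t. \<bar>g t\<bar> powr p \<partial>lebesgue01) / b powr p))"
      using i by (simp add: Bochner_Integration.integral_add)
    also have "\<dots> = (a + b) powr p * (a / (a + b) + b / (a + b))"
      using power[OF n(1)] power[OF n(2)] ab by simp
    also have "a / (a + b) + b / (a + b) = 1" using ab by (simp add: add_divide_distrib[symmetric])
    finally have le: "(\<integral>t. \<bar>f t + g t\<bar> powr p \<partial>lebesgue01) \<le> (a + b) powr p" by simp
    have "(\<integral>t. \<bar>f t + g t\<bar> powr p \<partial>lebesgue01) powr (1 / p) \<le> ((a + b) powr p) powr (1 / p)"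
      using p le by (intro powr_mono2) (auto intro: Bochner_Integration.integral_nonneg)
    also have "\<dots> = a + b" using p ab by (simp add: powr_powr)
    finally show "(\<integral>t. \<bar>f t + g t\<bar> powr p \<partial>lebesgue01) powr (1 / p) \<le> a + b" .
  qed
  have triangle: "Lp_norm p (f + g) \<le> Lp_norm p f + Lp_norm p g"
    if "in_Lp p f" "in_Lp p g" for f g
  proof (cases "f = 0 \<or> g = 0")
    case True
    then show ?thesis using nonneg by auto
  next
    case False
    then have "0 < Lp_norm p f" "0 < Lp_norm p g"
      using definite[OF that(1)] definite[OF that(2)] nonneg[of f] nonneg[of g] by force+
    then show ?thesis using pos[OF that refl refl] add[OF that] by blast
  qed
  show ?thesis
    unfolding normed_space_on_def subspace_def Lp_def mem_Collect_eq
    using zero add scale nonneg definite scale_eq triangle by blast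
qed

definition Lp_operators :: "real \<Rightarrow> (l0 \<Rightarrow> l0) set" where
  "Lp_operators p = bounded_operators (Lp p) (Lp_norm p) (Lp p) (Lp_norm p)"

definition Lp_operator_norm :: "real \<Rightarrow> (l0 \<Rightarrow> l0) \<Rightarrow> real" where
  "Lp_operator_norm p = operator_norm (Lp p) (Lp_norm p) (Lp_norm p)"

lemma normed_space_on_Lp_operators:
  "1 \<le> p \<Longrightarrow> normed_space_on (Lp_operators p) (Lp_operator_norm p)"
  unfolding Lp_operators_def Lp_operator_norm_def
  by (intro normed_space_on_bounded_operators normed_space_on_Lp)

end

theory Submission
  imports Defs
begin

text \<open>
  The property is a feature of all operator spaces \<open>B(V, W)\<close> in which \<open>V\<close> and \<open>W\<close> are separable and
  every unit vector \<open>f\<close> of \<open>V\<close> is strongly exposed: some functional \<open>\<phi>\<close> of norm \<open>1\<close> has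
  \<open>\<phi> f = 1\<close>, and points \<open>x\<close> of the unit ball with \<open>\<phi> x\<close> close to \<open>1\<close> are close to \<open>f\<close>.
  The balls are centred at large multiples of rank-one operators.

  Let \<open>T\<close> have norm \<open>1\<close>, let \<open>f\<close> be a unit vector on which \<open>T\<close> is not small, let \<open>g\<close> be close to
  \<open>T f\<close>, and let \<open>Z x = n (\<phi> x) g\<close>, an operator of norm \<open>n\<parallel>g\<parallel>\<close>.  For \<open>x\<close> in the unit ball,
  either \<open>\<bar>\<phi> x\<bar> \<le> 1 - \<delta>\<close>, and then \<open>\<parallel>Z x\<parallel>\<close> falls short of \<open>\<parallel>Z\<parallel>\<close> by at least \<open>n \<delta> \<parallel>g\<parallel>\<close>, which for
  large \<open>n\<close> outweighs \<open>\<parallel>T x\<parallel> \<le> 1\<close>; or, up to a sign, \<open>x\<close> is close to \<open>f\<close>, so that \<open>T x\<close> is close to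
  \<open>g\<close> and subtracting it from a large positive multiple of \<open>g\<close> shortens that multiple by almost
  \<open>\<parallel>g\<parallel>\<close>.  Hence \<open>\<parallel>T - Z\<parallel> < \<parallel>Z\<parallel>\<close> (lemma \<open>rank_one_ball_covers\<close>).  Since \<open>f\<close> and \<open>g\<close> may be chosen
  from countable dense sets, countably many balls suffice
  (theorem \<open>ball_covering_property_bounded_operators\<close>).

  For \<open>L\<^sub>p\<close> with \<open>1 < p\<close> the functional exposing \<open>f\<close> is
  \<open>h \<mapsto> \<integral> sgn f \<bar>f\<bar>\<^bsup>p-1\<^esup> h\<close>.  Both its norm and the strong exposure come from the gap in Young's
  inequality, \<open>\<bar>b\<bar>\<^bsup>p\<^esup> + (p - 1) \<bar>a\<bar>\<^bsup>p\<^esup> - p (sgn a \<bar>a\<bar>\<^bsup>p-1\<^esup>) b\<close>, which is nonnegative and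
  vanishes only for \<open>a = b\<close>; by homogeneity and compactness it controls \<open>\<bar>a - b\<bar>\<^bsup>p\<^esup>\<close> up to an
  arbitrarily small multiple of \<open>\<bar>a\<bar>\<^bsup>p\<^esup> + \<bar>b\<bar>\<^bsup>p\<^esup>\<close> (lemma \<open>dist_powr_le_young_gap\<close>).  Integrating
  gives lemma \<open>Lp_strongly_exposed\<close>.  Separability of \<open>L\<^sub>p\<close> follows because the indicators of
  half-lines with rational endpoints span a dense subspace.
\<close>

section \<open>Normed spaces and operators between them\<close>

locale normed_carrier =
  fixes V :: "'a::real_vector set" and N :: "'a \<Rightarrow> real"
  assumes normed: "normed_space_on V N"
begin

lemma subspace_carrier: "subspace V"
  and norm_ge_0: "x \<in> V \<Longrightarrow> 0 \<le> N x"
  and norm_eq_0_iff: "x \<in> V \<Longrightarrow> N x = 0 \<longleftrightarrow> x = 0"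
  and norm_scale: "x \<in> V \<Longrightarrow> N (c *\<^sub>R x) = \<bar>c\<bar> * N x"
  and norm_triangle: "x \<in> V \<Longrightarrow> y \<in> V \<Longrightarrow> N (x + y) \<le> N x + N y"
  using normed by (auto simp: normed_space_on_def)

lemma carrier_closed:
  "0 \<in> V" "x \<in> V \<Longrightarrow> y \<in> V \<Longrightarrow> x + y \<in> V" "x \<in> V \<Longrightarrow> y \<in> V \<Longrightarrow> x - y \<in> V"
  "x \<in> V \<Longrightarrow> c *\<^sub>R x \<in> V"
  using subspace_carrier by (auto intro: subspace_0 subspace_add subspace_diff subspace_scale)

lemma norm_0: "N 0 = 0"
  using norm_eq_0_iff carrier_closed(1) by blast

lemma norm_pos: "x \<in> V \<Longrightarrow> x \<noteq> 0 \<Longrightarrow> 0 < N x"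
  using norm_ge_0[of x] norm_eq_0_iff[of x] by linarith

lemma norm_minus_commute: "x \<in> V \<Longrightarrow> y \<in> V \<Longrightarrow> N (x - y) = N (y - x)"
  using norm_scale[of "y - x" "-1"] carrier_closed by simp

lemma norm_triangle_diff: "x \<in> V \<Longrightarrow> y \<in> V \<Longrightarrow> z \<in> V \<Longrightarrow> N (x - z) \<le> N (x - y) + N (y - z)"
  using norm_triangle[of "x - y" "y - z"] carrier_closed by simp

lemma norm_diff_le: "x \<in> V \<Longrightarrow> y \<in> V \<Longrightarrow> N (x - y) \<le> N x + N y"
  using norm_triangle_diff[of x 0 y] norm_minus_commute[of 0 y] carrier_closed by simp

lemma norm_diff_ge: "x \<in> V \<Longrightarrow> y \<in> V \<Longrightarrow> N x - N y \<le> N (x - y)"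
  using norm_triangle[of "x - y" y] carrier_closed by simp

end

definition separable_on :: "'a::real_vector set \<Rightarrow> ('a \<Rightarrow> real) \<Rightarrow> bool" where
  "separable_on V N \<longleftrightarrow> (\<exists>D\<subseteq>V. countable D \<and> (\<forall>x\<in>V. \<forall>e>0. \<exists>d\<in>D. N (x - d) < e))"

text \<open>
  The last conjunct quantifies the exposure: the slices of the unit ball cut off by \<open>\<phi>\<close> shrink to
  \<open>f\<close> in norm.
\<close>

definition strongly_exposes ::
  "'a::real_vector set \<Rightarrow> ('a \<Rightarrow> real) \<Rightarrow> ('a \<Rightarrow> real) \<Rightarrow> 'a \<Rightarrow> bool" where
  "strongly_exposes V N \<phi> f \<longleftrightarrow>
     f \<in> V \<and> N f = 1 \<and> \<phi> f = 1 \<and>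
     (\<forall>x\<in>V. \<forall>y\<in>V. \<phi> (x + y) = \<phi> x + \<phi> y) \<and> (\<forall>c. \<forall>x\<in>V. \<phi> (c *\<^sub>R x) = c * \<phi> x) \<and>
     (\<forall>x\<in>V. \<bar>\<phi> x\<bar> \<le> N x) \<and>
     (\<forall>e>0. \<exists>\<delta>>0. \<forall>x\<in>V. N x \<le> 1 \<longrightarrow> 1 - \<delta> \<le> \<phi> x \<longrightarrow> N (x - f) < e)"

text \<open>
  A ball may always be given the largest radius that is allowed for its centre, and a nonempty
  countable set of centres may be repeated to form a sequence.
\<close>

lemma ball_covering_propertyI:
  assumes "countable Z" "Z \<noteq> {}" "\<And>z. z \<in> Z \<Longrightarrow> z \<in> V \<and> z \<noteq> 0 \<and> 0 < N z"
    and cover: "\<And>x. x \<in> V \<Longrightarrow> N x = 1 \<Longrightarrow> \<exists>z\<in>Z. N (x - z) < N z"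
  shows "ball_covering_property V N"
  unfolding ball_covering_property_def
proof (intro exI conjI allI)
  let ?z = "from_nat_into Z"
  have z: "?z n \<in> Z" for n using assms(2) by (rule from_nat_into)
  show "?z n \<in> V - {0}" "0 < N (?z n)" "N (?z n) \<le> N (?z n)" for n
    using assms(3)[OF z[of n]] by auto
  show "unit_sphere_on V N \<subseteq> (\<Union>n. open_ball_on V N (?z n) (N (?z n)))"
  proof
    fix x assume x: "x \<in> unit_sphere_on V N"
    then obtain z where "z \<in> Z" "N (x - z) < N z"
      using cover by (auto simp: unit_sphere_on_def)
    moreover obtain n where "?z n = z"
      using from_nat_into_surj[OF assms(1) \<open>z \<in> Z\<close>] by blast
    ultimately show "x \<in> (\<Union>n. open_ball_on V N (?z n) (N (?z n)))"
      using x by (auto simp: unit_sphere_on_def open_ball_on_def)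
  qed
qed

locale normed_carrier_pair = V: normed_carrier V N + W: normed_carrier W M
  for V :: "'a::real_vector set" and N :: "'a \<Rightarrow> real"
    and W :: "'b::real_vector set" and M :: "'b \<Rightarrow> real"
begin

lemma operatorD:
  assumes "T \<in> bounded_operators V N W M"
  shows "x \<in> V \<Longrightarrow> T x \<in> W" "x \<in> V \<Longrightarrow> y \<in> V \<Longrightarrow> T (x + y) = T x + T y"
    "x \<in> V \<Longrightarrow> T (c *\<^sub>R x) = c *\<^sub>R T x" "x \<in> V \<Longrightarrow> y \<in> V \<Longrightarrow> T (x - y) = T x - T y"
proof -
  show add: "x \<in> V \<Longrightarrow> y \<in> V \<Longrightarrow> T (x + y) = T x + T y" for x y
    using assms by (auto simp: bounded_operators_def)
  show scale: "x \<in> V \<Longrightarrow> T (c *\<^sub>R x) = c *\<^sub>R T x" for c x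
    using assms by (auto simp: bounded_operators_def)
  show "x \<in> V \<Longrightarrow> T x \<in> W"
    using assms by (auto simp: bounded_operators_def)
  show "x \<in> V \<Longrightarrow> y \<in> V \<Longrightarrow> T (x - y) = T x - T y"
    using add[of x "(-1) *\<^sub>R y"] scale[of y "-1"] V.carrier_closed(4)[of y "-1"] by simp
qed

lemma operator_norm_upper:
  assumes T: "T \<in> bounded_operators V N W M" and x: "x \<in> V" "N x \<le> 1"
  shows "M (T x) \<le> operator_norm V N M T"
  unfolding operator_norm_def
proof (rule cSUP_upper)
  obtain C where C: "\<And>x. x \<in> V \<Longrightarrow> M (T x) \<le> C * N x"
    using T unfolding bounded_operators_def by blast
  have "M (T x) \<le> \<bar>C\<bar>" if "x \<in> V" "N x \<le> 1" for x
  proof -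
    have "M (T x) \<le> \<bar>C\<bar> * N x"
      using C[OF that(1)] mult_right_mono[OF abs_ge_self[of C] V.norm_ge_0[OF that(1)]] by linarith
    then show ?thesis using mult_left_mono[OF that(2), of "\<bar>C\<bar>"] by simp
  qed
  then show "bdd_above ((\<lambda>x. M (T x)) ` {x \<in> V. N x \<le> 1})"
    by (auto simp: bdd_above_def)
qed (use x in simp)

lemma operator_norm_least:
  assumes "\<And>x. x \<in> V \<Longrightarrow> N x \<le> 1 \<Longrightarrow> M (T x) \<le> K"
  shows "operator_norm V N M T \<le> K"
  unfolding operator_norm_def
  using assms V.carrier_closed(1) V.norm_0 by (intro cSUP_least) auto

lemma operator_norm_exceeds:
  assumes "K < operator_norm V N M T"
  obtains x where "x \<in> V" "N x \<le> 1" "K < M (T x)"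
  using operator_norm_least[of T K] assms by (meson not_le)

lemma operator_bound:
  assumes T: "T \<in> bounded_operators V N W M" and "x \<in> V"
  shows "M (T x) \<le> operator_norm V N M T * N x"
proof (cases "x = 0")
  case True
  have "T 0 = 0" using operatorD(3)[OF T V.carrier_closed(1), of 0] by simp
  then show ?thesis using True V.norm_0 W.norm_0 by simp
next
  case False
  let ?y = "inverse (N x) *\<^sub>R x"
  have pos: "0 < N x" using V.norm_pos assms False by blast
  have "M (T ?y) \<le> operator_norm V N M T"
    using pos assms V.norm_scale V.carrier_closed by (intro operator_norm_upper) auto
  then show ?thesis
    using pos operatorD[OF T] assms(2) W.norm_scale by (simp add: field_simps)
qed

end

section \<open>Covering the sphere of an operator space by rank-one operators\<close>

definition rank_one :: "'a set \<Rightarrow> ('a \<Rightarrow> real) \<Rightarrow> 'b \<Rightarrow> 'a \<Rightarrow> 'b::real_vector" where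
  "rank_one V \<phi> g = (\<lambda>x. if x \<in> V then \<phi> x *\<^sub>R g else 0)"

context normed_carrier_pair
begin

lemma rank_one_operator:
  assumes \<phi>: "strongly_exposes V N \<phi> f" and g: "g \<in> W"
  shows "c *\<^sub>R rank_one V \<phi> g \<in> bounded_operators V N W M"
    and "operator_norm V N M (c *\<^sub>R rank_one V \<phi> g) = \<bar>c\<bar> * M g"
proof -
  have b: "\<bar>\<phi> x\<bar> \<le> N x" if "x \<in> V" for x
    using \<phi> that by (auto simp: strongly_exposes_def)
  have n: "M ((c *\<^sub>R rank_one V \<phi> g) x) = \<bar>c\<bar> * (\<bar>\<phi> x\<bar> * M g)" if "x \<in> V" for x
    using that g by (simp add: rank_one_def scaleR_fun_def W.norm_scale W.carrier_closed abs_mult)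
  have "M ((c *\<^sub>R rank_one V \<phi> g) x) \<le> (\<bar>c\<bar> * M g) * N x" if "x \<in> V" for x
    using n[OF that] mult_left_mono[OF mult_right_mono[OF b[OF that] W.norm_ge_0[OF g]], of "\<bar>c\<bar>"]
    by (simp add: mult_ac)
  then have "\<exists>C. \<forall>x\<in>V. M ((c *\<^sub>R rank_one V \<phi> g) x) \<le> C * N x" by blast
  then show op: "c *\<^sub>R rank_one V \<phi> g \<in> bounded_operators V N W M"
    using \<phi> g unfolding bounded_operators_def strongly_exposes_def
    by (auto simp: rank_one_def scaleR_fun_def W.carrier_closed V.carrier_closed scaleR_add_left scaleR_add_right mult.left_commute)
  show "operator_norm V N M (c *\<^sub>R rank_one V \<phi> g) = \<bar>c\<bar> * M g"
  proof (rule antisym)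
    show "operator_norm V N M (c *\<^sub>R rank_one V \<phi> g) \<le> \<bar>c\<bar> * M g"
    proof (rule operator_norm_least)
      fix x assume x: "x \<in> V" "N x \<le> 1"
      have "\<bar>\<phi> x\<bar> * M g \<le> 1 * M g"
        using b[OF x(1)] x(2) W.norm_ge_0[OF g] by (intro mult_right_mono) auto
      then show "M ((c *\<^sub>R rank_one V \<phi> g) x) \<le> \<bar>c\<bar> * M g"
        unfolding n[OF x(1)] by (intro mult_left_mono) auto
    qed
    have "f \<in> V" "N f = 1" "\<phi> f = 1" using \<phi> by (auto simp: strongly_exposes_def)
    then show "\<bar>c\<bar> * M g \<le> operator_norm V N M (c *\<^sub>R rank_one V \<phi> g)"
      using operator_norm_upper[OF op, of f] n[of f] by simp
  qed
qed

text \<open>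
  The unit ball of \<open>V\<close> splits into two opposite slices around \<open>f\<close> and \<open>-f\<close>, on which \<open>T x\<close> points
  in nearly the same direction as \<open>n (\<phi> x) g\<close>, and a remainder, on which \<open>n (\<phi> x) g\<close> is much shorter
  than \<open>n g\<close>.  On each part, \<open>n (\<phi> x) g - T x\<close> is shorter than \<open>n g\<close> by at least \<open>1/4\<close>.
\<close>

lemma rank_one_ball_covers:
  assumes T: "T \<in> bounded_operators V N W M" and T1: "operator_norm V N M T \<le> 1"
    and \<phi>: "strongly_exposes V N \<phi> f" and Tf: "1/2 < M (T f)"
    and g: "g \<in> W" and Tg: "M (T f - g) < 1/16"
  obtains n :: nat where "n > 0"
    "operator_norm V N M (T - real n *\<^sub>R rank_one V \<phi> g)
       < operator_norm V N M (real n *\<^sub>R rank_one V \<phi> g)"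
proof -
  have f: "f \<in> V" "N f = 1" "\<phi> f = 1"
    and \<phi>s: "\<And>c x. x \<in> V \<Longrightarrow> \<phi> (c *\<^sub>R x) = c * \<phi> x"
    and \<phi>b: "\<And>x. x \<in> V \<Longrightarrow> \<bar>\<phi> x\<bar> \<le> N x"
    using \<phi> by (auto simp: strongly_exposes_def)
  obtain \<delta> where \<delta>: "\<delta> > 0" "\<And>x. x \<in> V \<Longrightarrow> N x \<le> 1 \<Longrightarrow> 1 - \<delta> \<le> \<phi> x \<Longrightarrow> N (x - f) < 1/8"
    using \<phi> unfolding strongly_exposes_def
    by (metis zero_less_divide_1_iff zero_less_numeral)
  have bound: "M (T x) \<le> N x" if "x \<in> V" for x
    using operator_bound[OF T that] mult_right_mono[OF T1 V.norm_ge_0[OF that]] by simp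
  have Tw: "T x \<in> W" if "x \<in> V" for x using operatorD[OF T] that by blast
  have g7: "7/16 < M g"
    using W.norm_diff_ge[of "T f" g] Tw f g Tf Tg by force
  obtain n0 :: nat where n0: "4 / \<delta> + 8 < real n0" using reals_Archimedean2 by blast
  define n where "n = real n0"
  have "0 < 4 / \<delta>" using \<delta> by simp
  then have "8 < n" "4 / \<delta> < n" using n0 unfolding n_def by linarith+
  then have n: "8 < n" "4 < n * \<delta>"
    using \<delta>(1) by (simp_all add: pos_divide_less_eq)
  \<comment> \<open>The scalar \<open>n \<phi> x\<close> is at least \<open>1\<close> here, so that subtracting \<open>g\<close> from \<open>(n \<phi> x) g\<close> reduces its
    norm by all of \<open>M g\<close>; the error in replacing \<open>T x\<close> by \<open>g\<close> is less than \<open>1/8 + 1/16\<close>.\<close>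
  have slice: "M (T x - (n * \<phi> x) *\<^sub>R g) \<le> n * M g - 1/4"
    if x: "x \<in> V" "N x \<le> 1" and near: "1 - min \<delta> (1/2) \<le> \<phi> x" for x
  proof -
    have "N (x - f) < 1/8" using \<delta>(2)[OF x] near by simp
    then have "M (T x - T f) < 1/8"
      using bound[of "x - f"] operatorD(4)[OF T x(1) f(1)] x f V.carrier_closed by force
    then have 1: "M (T x - g) < 3/16"
      using W.norm_triangle_diff[of "T x" "T f" g] Tw x f g Tg by force
    have "1/2 \<le> \<phi> x" using near by linarith
    then have "1 \<le> n * \<phi> x"
      using mult_mono[of 2 n "1/2" "\<phi> x"] n by simp
    moreover have "\<phi> x \<le> 1" using \<phi>b[OF x(1)] x(2) by simp
    then have "n * \<phi> x \<le> n" using n by simp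
    moreover have "g - (n * \<phi> x) *\<^sub>R g = (1 - n * \<phi> x) *\<^sub>R g" by (simp add: algebra_simps)
    ultimately have "M (g - (n * \<phi> x) *\<^sub>R g) \<le> (n - 1) * M g"
      using W.norm_scale[OF g, of "1 - n * \<phi> x"] W.norm_ge_0[OF g] by (simp add: mult_right_mono)
    moreover have "M (T x - (n * \<phi> x) *\<^sub>R g) \<le> M (T x - g) + M (g - (n * \<phi> x) *\<^sub>R g)"
      by (rule W.norm_triangle_diff[OF Tw[OF x(1)] g W.carrier_closed(4)[OF g]])
    ultimately show ?thesis using 1 g7 by (simp add: algebra_simps)
  qed
  \<comment> \<open>The choice of \<open>n\<close> makes \<open>n min \<delta> (1/2) \<ge> 4\<close>, and \<open>M g > 7/16\<close>, so the loss in length exceeds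
    \<open>1 + 1/4\<close>, while \<open>T x\<close> has norm at most \<open>1\<close>.\<close>
  have far: "M (T x - (n * \<phi> x) *\<^sub>R g) \<le> n * M g - 1/4"
    if x: "x \<in> V" "N x \<le> 1" and "\<bar>\<phi> x\<bar> \<le> 1 - min \<delta> (1/2)" for x
  proof -
    have "M (T x - (n * \<phi> x) *\<^sub>R g) \<le> M (T x) + n * (\<bar>\<phi> x\<bar> * M g)"
      using W.norm_diff_le[of "T x" "(n * \<phi> x) *\<^sub>R g"] W.norm_scale[OF g] Tw x g W.carrier_closed n
      by (simp add: abs_mult mult.assoc)
    also have "\<dots> \<le> 1 + n * ((1 - min \<delta> (1/2)) * M g)"
      using bound[OF x(1)] x n that W.norm_ge_0[OF g]
      by (intro add_mono mult_left_mono mult_right_mono) auto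
    also have "\<dots> = 1 + n * M g - (n * min \<delta> (1/2)) * M g"
      by (simp add: algebra_simps)
    finally have "M (T x - (n * \<phi> x) *\<^sub>R g) \<le> 1 + n * M g - (n * min \<delta> (1/2)) * M g" .
    moreover have "4 * (7/16) \<le> (n * min \<delta> (1/2)) * M g"
      using n g7 by (intro mult_mono) (auto simp: min_def)
    ultimately show ?thesis by simp
  qed
  have "operator_norm V N M (T - n *\<^sub>R rank_one V \<phi> g) \<le> n * M g - 1/4"
  proof (rule operator_norm_least)
    fix x assume x: "x \<in> V" "N x \<le> 1"
    have eq: "(T - n *\<^sub>R rank_one V \<phi> g) x = T x - (n * \<phi> x) *\<^sub>R g"
      using x by (simp add: rank_one_def scaleR_fun_def)
    consider "1 - min \<delta> (1/2) \<le> \<phi> x" | "1 - min \<delta> (1/2) \<le> - \<phi> x" | "\<bar>\<phi> x\<bar> \<le> 1 - min \<delta> (1/2)"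
      by linarith
    then show "M ((T - n *\<^sub>R rank_one V \<phi> g) x) \<le> n * M g - 1/4"
    proof cases
      case 1
      then show ?thesis using slice[OF x] eq by simp
    next
      case 2
      let ?y = "(-1) *\<^sub>R x"
      have y: "?y \<in> V" "N ?y \<le> 1" "\<phi> ?y = - \<phi> x"
        using x V.carrier_closed(4)[of x "-1"] V.norm_scale[of x "-1"] \<phi>s[of x "-1"] by auto
      have "T ?y - (n * \<phi> ?y) *\<^sub>R g = (-1) *\<^sub>R (T x - (n * \<phi> x) *\<^sub>R g)"
        unfolding y(3) operatorD(3)[OF T x(1)] by (simp add: algebra_simps)
      then have "M (T ?y - (n * \<phi> ?y) *\<^sub>R g) = M (T x - (n * \<phi> x) *\<^sub>R g)"
        using W.norm_scale[of "T x - (n * \<phi> x) *\<^sub>R g" "-1"] Tw x g W.carrier_closed by simp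
      then show ?thesis using slice[OF y(1,2)] 2 y(3) eq by simp
    next
      case 3
      then show ?thesis using far[OF x] eq by simp
    qed
  qed
  moreover have "operator_norm V N M (n *\<^sub>R rank_one V \<phi> g) = n * M g"
    using rank_one_operator(2)[OF \<phi> g, of n] n by simp
  ultimately show ?thesis
    using that[of n0] n by (simp add: n_def)
qed

text \<open>
  The exposed vectors are the normalised elements of a dense set.  If \<open>x\<close> is in the unit ball and
  \<open>\<parallel>T x\<parallel> > 3/4\<close>, approximating \<open>x\<close> up to \<open>1/16\<close> and normalising gives such a vector \<open>f\<close> with
  \<open>\<parallel>T f\<parallel> > (11/16) / (17/16) > 1/2\<close>.
\<close>

theorem ball_covering_property_bounded_operators:
  assumes sepV: "separable_on V N" and sepW: "separable_on W M"
    and nz: "V \<noteq> {0}" "W \<noteq> {0}"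
    and exposed: "\<And>f. f \<in> V \<Longrightarrow> N f = 1 \<Longrightarrow> \<exists>\<phi>. strongly_exposes V N \<phi> f"
  shows "ball_covering_property (bounded_operators V N W M) (operator_norm V N M)"
proof -
  obtain D where D: "D \<subseteq> V" "countable D" "\<And>x e. x \<in> V \<Longrightarrow> 0 < e \<Longrightarrow> \<exists>d\<in>D. N (x - d) < e"
    using sepV unfolding separable_on_def by metis
  obtain G where G: "G \<subseteq> W" "countable G" "\<And>x e. x \<in> W \<Longrightarrow> 0 < e \<Longrightarrow> \<exists>d\<in>G. M (x - d) < e"
    using sepW unfolding separable_on_def by metis
  have exD: "\<exists>d\<in>D. d \<noteq> 0 \<and> N (x - d) < e" if "x \<in> V" "x \<noteq> 0" "0 < e" for x e
    using D(3)[OF that(1), of "min e (N x)"] V.norm_pos[OF that(1,2)] that(3)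
    by (metis diff_zero less_irrefl min_less_iff_conj)
  have exG: "\<exists>d\<in>G. d \<noteq> 0 \<and> M (x - d) < e" if "x \<in> W" "x \<noteq> 0" "0 < e" for x e
    using G(3)[OF that(1), of "min e (M x)"] W.norm_pos[OF that(1,2)] that(3)
    by (metis diff_zero less_irrefl min_less_iff_conj)
  define F where "F = (\<lambda>d. inverse (N d) *\<^sub>R d) ` (D - {0})"
  have F: "f \<in> V" "N f = 1" if f: "f \<in> F" for f
  proof -
    obtain d where d: "d \<in> V" "d \<noteq> 0" "f = inverse (N d) *\<^sub>R d"
      using f D(1) by (auto simp: F_def)
    show "f \<in> V" "N f = 1"
      using d V.norm_pos[OF d(1,2)] by (simp_all add: V.carrier_closed V.norm_scale)
  qed
  obtain \<phi> where \<phi>: "\<And>f. f \<in> F \<Longrightarrow> strongly_exposes V N (\<phi> f) f"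
    using bchoice[of F "\<lambda>f \<phi>. strongly_exposes V N \<phi> f"] exposed F by blast
  define Z where "Z = (\<lambda>(f, g, n). real n *\<^sub>R rank_one V (\<phi> f) g) ` (F \<times> (G - {0}) \<times> {0<..})"
  have Z: "real n *\<^sub>R rank_one V (\<phi> f) g \<in> Z" if "f \<in> F" "g \<in> G" "g \<noteq> 0" "n > 0" for f g n
    using that unfolding Z_def by (intro image_eqI[of _ _ "(f, g, n)"]) auto
  show ?thesis
  proof (rule ball_covering_propertyI)
    show "countable Z" using D(2) G(2) by (auto simp: Z_def F_def)
    obtain x where x: "x \<in> V" "x \<noteq> 0" using nz(1) V.carrier_closed(1) by blast
    obtain y where y: "y \<in> W" "y \<noteq> 0" using nz(2) W.carrier_closed(1) by blast
    from exD[OF x, of 1] obtain f where "f \<in> F" by (auto simp: F_def)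
    moreover from exG[OF y, of 1] obtain g where "g \<in> G" "g \<noteq> 0" by auto
    ultimately show "Z \<noteq> {}" using Z[of f g 1] by auto
  next
    fix z assume "z \<in> Z"
    then obtain f g and n :: nat
      where z: "f \<in> F" "g \<in> G" "g \<noteq> 0" "n > 0" "z = real n *\<^sub>R rank_one V (\<phi> f) g"
      unfolding Z_def by auto
    have g: "g \<in> W" using z G(1) by auto
    have "0 < operator_norm V N M z"
      using z rank_one_operator(2)[OF \<phi>[OF z(1)] g] W.norm_pos[OF g] by simp
    moreover have "operator_norm V N M 0 \<le> 0"
      using W.norm_0 by (intro operator_norm_least) simp
    ultimately show "z \<in> bounded_operators V N W M \<and> z \<noteq> 0 \<and> 0 < operator_norm V N M z"
      using rank_one_operator(1)[OF \<phi>[OF z(1)] g, of "real n"] unfolding z(5)[symmetric]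
      by (metis not_le)
  next
    fix T assume T: "T \<in> bounded_operators V N W M" "operator_norm V N M T = 1"
    obtain x where x: "x \<in> V" "N x \<le> 1" "3/4 < M (T x)"
      using operator_norm_exceeds[of "3/4" T] T(2) by auto
    have bound: "M (T v) \<le> N v" if "v \<in> V" for v
      using operator_bound[OF T(1) that] T(2) by simp
    have "x \<noteq> 0" using bound[OF x(1)] x(3) V.norm_0 by auto
    then obtain d where d: "d \<in> D" "d \<noteq> 0" "N (x - d) < 1/16"
      using exD[OF x(1), of "1/16"] by auto
    have dV: "d \<in> V" using d D by auto
    have pos: "0 < N d" using V.norm_pos dV d by auto
    have "N d < 17/16"
      using V.norm_diff_ge[OF dV x(1)] V.norm_minus_commute[OF dV x(1)] d(3) x(2) by linarith
    moreover have "11/16 < M (T d)"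
      using W.norm_diff_ge[OF operatorD(1)[OF T(1) x(1)] operatorD(1)[OF T(1) dV]]
        operatorD(4)[OF T(1) x(1) dV] bound[OF V.carrier_closed(3)[OF x(1) dV]] x(3) d(3) by simp
    ultimately have "1/2 < M (T (inverse (N d) *\<^sub>R d))"
      using pos operatorD(1,3)[OF T(1) dV] by (simp add: W.norm_scale field_simps)
    moreover define f where "f = inverse (N d) *\<^sub>R d"
    ultimately have f: "f \<in> F" "1/2 < M (T f)" using d by (auto simp: F_def)
    have Tf: "T f \<in> W" "T f \<noteq> 0"
      using operatorD(1)[OF T(1) F(1)[OF f(1)]] f(2) W.norm_0 by auto
    then obtain g where g: "g \<in> G" "g \<noteq> 0" "M (T f - g) < 1/16"
      using exG[of "T f" "1/16"] by auto
    have "g \<in> W" using g G(1) by auto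
    then obtain n :: nat where "n > 0"
      "operator_norm V N M (T - real n *\<^sub>R rank_one V (\<phi> f) g)
         < operator_norm V N M (real n *\<^sub>R rank_one V (\<phi> f) g)"
      using rank_one_ball_covers[OF T(1) _ \<phi>[OF f(1)] f(2) _ g(3)] T(2) by (metis order_refl)
    then show "\<exists>z\<in>Z. operator_norm V N M (T - z) < operator_norm V N M z"
      using Z[OF f(1) g(1,2)] by blast
  qed
qed

end

section \<open>The gap in Young's inequality\<close>

definition signed_powr :: "real \<Rightarrow> real \<Rightarrow> real" where
  "signed_powr r a = sgn a * \<bar>a\<bar> powr r"

definition young_gap :: "real \<Rightarrow> real \<Rightarrow> real \<Rightarrow> real" where
  "young_gap p a b = \<bar>b\<bar> powr p + (p - 1) * \<bar>a\<bar> powr p - p * (signed_powr (p - 1) a * b)"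

lemma young_gap_same: "1 < p \<Longrightarrow> young_gap p a a = 0"
  by (cases "a = 0")
    (auto simp: young_gap_def signed_powr_def powr_diff mult_sgn_abs sgn_if abs_if algebra_simps)

lemma signed_powr_self: "signed_powr (p - 1) a * a = \<bar>a\<bar> powr p"
  by (cases "a = 0") (auto simp: signed_powr_def powr_diff sgn_if abs_if)

lemma young_gap_scale:
  assumes "0 < c"
  shows "young_gap p (c * a) (c * b) = c powr p * young_gap p a b"
  using assms
  by (simp add: young_gap_def signed_powr_def abs_mult powr_mult sgn_mult powr_diff algebra_simps)

text \<open>Strict convexity of \<open>x \<mapsto> x\<^bsup>p\<^esup>\<close> on the positive half-line, by the mean value theorem.\<close>

lemma powr_above_tangent:
  fixes s \<alpha> p :: real
  assumes p: "1 < p" and s: "0 < s" and \<alpha>: "0 < \<alpha>" and ne: "s \<noteq> \<alpha>"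
  shows "\<alpha> powr p + p * \<alpha> powr (p - 1) * (s - \<alpha>) < s powr p"
proof (cases "\<alpha> < s")
  case True
  obtain z where z: "\<alpha> < z" "z < s" "s powr p - \<alpha> powr p = (s - \<alpha>) * (p * z powr (p - 1))"
    using MVT2[OF True, of "\<lambda>x. x powr p" "\<lambda>x. p * x powr (p - 1)"] \<alpha>
    by (force intro: has_real_derivative_powr)
  have "(s - \<alpha>) * (p * \<alpha> powr (p - 1)) < (s - \<alpha>) * (p * z powr (p - 1))"
    using True p z \<alpha> by (intro mult_strict_left_mono powr_less_mono2) auto
  then show ?thesis using z(3) by (simp only: mult_ac)
next
  case False
  then have lt: "s < \<alpha>" using ne by simp
  obtain z where z: "s < z" "z < \<alpha>" "\<alpha> powr p - s powr p = (\<alpha> - s) * (p * z powr (p - 1))"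
    using MVT2[OF lt, of "\<lambda>x. x powr p" "\<lambda>x. p * x powr (p - 1)"] s
    by (force intro: has_real_derivative_powr)
  have "(\<alpha> - s) * (p * z powr (p - 1)) < (\<alpha> - s) * (p * \<alpha> powr (p - 1))"
    using lt p z s by (intro mult_strict_left_mono powr_less_mono2) auto
  moreover have "p * \<alpha> powr (p - 1) * (s - \<alpha>) = - ((\<alpha> - s) * (p * \<alpha> powr (p - 1)))"
    by (simp add: algebra_simps)
  ultimately show ?thesis using z(3) by linarith
qed

text \<open>
  For \<open>a \<noteq> 0\<close> the gap is the vertical distance at \<open>s = sgn a * b\<close> between the
  graph of \<open>x \<mapsto> \<bar>x\<bar>\<^bsup>p\<^esup>\<close> and its tangent at \<open>\<bar>a\<bar>\<close>.
\<close>

lemma young_gap_pos: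
  assumes p: "1 < p" and ne: "a \<noteq> b"
  shows "0 < young_gap p a b"
proof (cases "a = 0")
  case True
  then show ?thesis using ne by (simp add: young_gap_def signed_powr_def)
next
  case False
  define \<alpha> s where "\<alpha> = \<bar>a\<bar>" and "s = sgn a * b"
  have \<alpha>: "0 < \<alpha>" and s: "s \<noteq> \<alpha>" "\<bar>s\<bar> = \<bar>b\<bar>"
    using False ne by (auto simp: \<alpha>_def s_def sgn_if abs_if)
  have gap: "young_gap p a b = \<bar>s\<bar> powr p + (p - 1) * \<alpha> powr p - p * \<alpha> powr (p - 1) * s"
    unfolding young_gap_def signed_powr_def s(2) by (simp add: \<alpha>_def s_def mult_ac)
  show ?thesis
  proof (cases "0 < s")
    case True
    have "\<alpha> powr (p - 1) * \<alpha> = \<alpha> powr p" using \<alpha> by (simp add: powr_diff)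
    then have "p * \<alpha> powr (p - 1) * (s - \<alpha>) = p * \<alpha> powr (p - 1) * s - p * \<alpha> powr p"
      by (simp add: algebra_simps)
    then have "young_gap p a b = s powr p - (\<alpha> powr p + p * \<alpha> powr (p - 1) * (s - \<alpha>))"
      using True unfolding gap by (simp add: left_diff_distrib)
    then show ?thesis using powr_above_tangent[OF p True \<alpha> s(1)] by simp
  next
    case False
    have "p * \<alpha> powr (p - 1) * s \<le> 0"
      using p False by (intro mult_nonneg_nonpos) auto
    moreover have "0 < (p - 1) * \<alpha> powr p" using p \<alpha> by simp
    moreover have "0 \<le> \<bar>s\<bar> powr p" by simp
    ultimately show ?thesis unfolding gap by linarith
  qed
qed

lemma young_gap_nonneg: "1 < p \<Longrightarrow> 0 \<le> young_gap p a b"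
  using young_gap_pos[of p a b] young_gap_same[of p a] by (cases "a = b") auto

text \<open>
  This form of Young's inequality, with a crude constant, serves to dominate the integrand of the
  pairing of two \<open>L\<^sub>p\<close> functions.
\<close>

lemma signed_powr_mult_le:
  assumes "1 < p"
  shows "\<bar>signed_powr (p - 1) a * b\<bar> \<le> \<bar>b\<bar> powr p + (p - 1) * \<bar>a\<bar> powr p"
proof -
  have "\<bar>p * (signed_powr (p - 1) a * b)\<bar> \<le> \<bar>b\<bar> powr p + (p - 1) * \<bar>a\<bar> powr p"
    using young_gap_nonneg[OF assms, of a b] young_gap_nonneg[OF assms, of a "- b"]
    by (simp add: young_gap_def abs_le_iff)
  then have "p * \<bar>signed_powr (p - 1) a * b\<bar> \<le> \<bar>b\<bar> powr p + (p - 1) * \<bar>a\<bar> powr p"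
    using assms by (simp add: abs_mult[of p])
  moreover have "1 * \<bar>signed_powr (p - 1) a * b\<bar> \<le> p * \<bar>signed_powr (p - 1) a * b\<bar>"
    using assms by (intro mult_right_mono) auto
  ultimately show ?thesis by simp
qed

lemma continuous_on_young_gap:
  assumes p: "1 < p"
  shows "continuous_on UNIV (\<lambda>x. young_gap p (fst x) (snd x))"
proof -
  \<comment> \<open>The sign function jumps at \<open>0\<close>; this formula has only continuous ingredients.\<close>
  have "signed_powr (p - 1) a = max a 0 powr (p - 1) - max (- a) 0 powr (p - 1)" for a
    by (auto simp: signed_powr_def sgn_if abs_if max_def)
  then show ?thesis
    unfolding young_gap_def using p by (auto intro!: continuous_intros continuous_on_powr')
qed

text \<open>
  This is the source of the uniform convexity used below.  Both sides are homogeneous of degree \<open>p\<close>,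
  so it suffices to consider \<open>max \<bar>a\<bar> \<bar>b\<bar> = 1\<close>.  There the first summand alone is enough unless
  \<open>\<bar>a - b\<bar>\<^bsup>p\<^esup> \<ge> e\<close>, and on the compact set \<open>K\<close> of pairs with that property the gap is bounded away
  from \<open>0\<close>.
\<close>

lemma dist_powr_le_young_gap:
  assumes p: "1 < p" and e: "0 < e"
  obtains C where "0 < C"
    "\<And>a b. \<bar>a - b\<bar> powr p \<le> e * (\<bar>a\<bar> powr p + \<bar>b\<bar> powr p) + C * young_gap p a b"
proof -
  let ?Q = "\<lambda>C a b. \<bar>a - b\<bar> powr p \<le> e * (\<bar>a\<bar> powr p + \<bar>b\<bar> powr p) + C * young_gap p a b"
  let ?gap = "\<lambda>x. young_gap p (fst x) (snd x)"
  define K where "K = ({-1..1} \<times> {-1..1}) \<inter>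
    {x::real\<times>real. max \<bar>fst x\<bar> \<bar>snd x\<bar> = 1 \<and> e \<le> \<bar>fst x - snd x\<bar> powr p}"
  have "closed {x::real\<times>real. max \<bar>fst x\<bar> \<bar>snd x\<bar> = 1 \<and> e \<le> \<bar>fst x - snd x\<bar> powr p}"
    using p by (intro closed_Collect_conj closed_Collect_eq closed_Collect_le
      continuous_intros continuous_on_powr') auto
  then have K: "compact K"
    unfolding K_def by (intro compact_Int_closed compact_Times) auto
  have "\<exists>m>0. \<forall>x\<in>K. m \<le> ?gap x"
  proof (cases "K = {}")
    case True
    then show ?thesis by (auto intro: exI[of _ 1])
  next
    case False
    obtain x where x: "x \<in> K" "\<forall>y\<in>K. ?gap x \<le> ?gap y"
      using continuous_attains_inf[OF K False continuous_on_subset[OF continuous_on_young_gap[OF p]]]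
      by auto
    have "fst x \<noteq> snd x" using x(1) e p by (auto simp: K_def)
    then show ?thesis using x(2) young_gap_pos[OF p] by blast
  qed
  then obtain m where m: "0 < m" "\<And>x. x \<in> K \<Longrightarrow> m \<le> ?gap x" by blast
  define C where "C = 2 powr p / m"
  have C: "0 < C" using m by (simp add: C_def)
  have unit: "?Q C a b" if "max \<bar>a\<bar> \<bar>b\<bar> = 1" for a b
  proof (cases "e \<le> \<bar>a - b\<bar> powr p")
    case True
    then have "m \<le> young_gap p a b" using that m(2)[of "(a, b)"]
      by (simp add: K_def abs_le_iff max_def split: if_splits) linarith+
    then have "C * m \<le> C * young_gap p a b" using C by simp
    moreover have "\<bar>a - b\<bar> powr p \<le> 2 powr p"
      using that p by (intro powr_mono2) (auto simp: max_def split: if_splits)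
    moreover have "0 \<le> e * (\<bar>a\<bar> powr p + \<bar>b\<bar> powr p)" using e by simp
    ultimately show ?thesis using m by (simp add: C_def)
  next
    case False
    have "1 \<le> \<bar>a\<bar> powr p + \<bar>b\<bar> powr p"
      using that by (auto simp: max_def split: if_splits)
    then have "e * 1 \<le> e * (\<bar>a\<bar> powr p + \<bar>b\<bar> powr p)" using e by (intro mult_left_mono) auto
    moreover have "0 \<le> C * young_gap p a b" using C young_gap_nonneg[OF p] by simp
    ultimately show ?thesis using False by linarith
  qed
  have "?Q C a b" for a b
  proof (cases "a = 0 \<and> b = 0")
    case True
    then show ?thesis using young_gap_same[OF p, of 0] by simp
  next
    case False
    define c where "c = max \<bar>a\<bar> \<bar>b\<bar>"
    have c: "0 < c" using False by (auto simp: c_def max_def)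
    have "max \<bar>a / c\<bar> \<bar>b / c\<bar> = 1"
      using c unfolding c_def by (auto simp: max_def field_simps)
    from mult_left_mono[OF unit[OF this], of "c powr p"]
    have "(c * \<bar>a / c - b / c\<bar>) powr p \<le>
       e * ((c * \<bar>a / c\<bar>) powr p + (c * \<bar>b / c\<bar>) powr p) + C * (c powr p * young_gap p (a / c) (b / c))"
      unfolding powr_mult by (simp add: algebra_simps)
    also have "c powr p * young_gap p (a / c) (b / c) = young_gap p a b"
      using young_gap_scale[OF c, of p "a / c" "b / c"] c by simp
    also have "c * \<bar>a / c - b / c\<bar> = \<bar>a - b\<bar>"
      using c by (simp add: diff_divide_distrib[symmetric])
    finally show ?thesis using c by simp
  qed
  then show ?thesis using that C by blast
qed

section \<open>Strong exposure in \<open>L\<^sub>p\<close>\<close>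

definition Lp_function :: "real \<Rightarrow> (real \<Rightarrow> real) \<Rightarrow> bool" where
  "Lp_function p g \<longleftrightarrow>
     g \<in> borel_measurable lebesgue01 \<and> integrable lebesgue01 (\<lambda>t. \<bar>g t\<bar> powr p)"

lemma ae_eq01_refl: "ae_eq01 g g \<longleftrightarrow> g \<in> borel_measurable lebesgue01"
  by (simp add: ae_eq01_def)

lemma abs_l0_in_Lp_iff:
  "g \<in> borel_measurable lebesgue01 \<Longrightarrow> abs_l0 g \<in> Lp p \<longleftrightarrow> Lp_function p g"
  by (simp add: Lp_def Lp_function_def in_Lp.abs_eq ae_eq01_refl)

lemma Lp_cases:
  assumes "x \<in> Lp p"
  obtains g where "Lp_function p g" "x = abs_l0 g"
proof -
  have x: "ae_eq01 (rep_l0 x) (rep_l0 x)" "x = abs_l0 (rep_l0 x)"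
    using Quotient3_rep_reflp[OF Quotient3_l0] Quotient3_abs_rep[OF Quotient3_l0] by auto
  then show ?thesis
    using that[of "rep_l0 x"] assms abs_l0_in_Lp_iff by (metis ae_eq01_refl)
qed

lemma Lp_function_abs:
  assumes "Lp_function p g" shows "abs_l0 g \<in> Lp p"
  using assms abs_l0_in_Lp_iff by (auto simp: Lp_function_def)

lemma abs_l0_algebra:
  assumes "f \<in> borel_measurable lebesgue01"
  shows "g \<in> borel_measurable lebesgue01 \<Longrightarrow> abs_l0 f + abs_l0 g = abs_l0 (\<lambda>t. f t + g t)"
    "g \<in> borel_measurable lebesgue01 \<Longrightarrow> abs_l0 f - abs_l0 g = abs_l0 (\<lambda>t. f t - g t)"
    "c *\<^sub>R abs_l0 f = abs_l0 (\<lambda>t. c * f t)"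
  using assms by (simp_all add: plus_l0.abs_eq minus_l0.abs_eq scaleR_l0.abs_eq ae_eq01_refl)

lemma Lp_norm_abs_powr:
  assumes "0 < p" "g \<in> borel_measurable lebesgue01"
  shows "Lp_norm p (abs_l0 g) powr p = (\<integral>t. \<bar>g t\<bar> powr p \<partial>lebesgue01)"
  using assms Bochner_Integration.integral_nonneg[of lebesgue01 "\<lambda>t. \<bar>g t\<bar> powr p"]
  by (simp add: Lp_norm.abs_eq ae_eq01_refl powr_powr)

lift_definition Lp_duality :: "real \<Rightarrow> l0 \<Rightarrow> l0 \<Rightarrow> real" is
  "\<lambda>p f h. \<integral>t. signed_powr (p - 1) (f t) * h t \<partial>lebesgue01"
  unfolding ae_eq01_def signed_powr_def
  by (intro integral_cong_AE) (auto elim: eventually_elim2)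

lemma Lp_duality_abs:
  assumes "f \<in> borel_measurable lebesgue01" "g \<in> borel_measurable lebesgue01"
  shows "Lp_duality p (abs_l0 f) (abs_l0 g) = (\<integral>t. signed_powr (p - 1) (f t) * g t \<partial>lebesgue01)"
  using assms by (simp add: Lp_duality.abs_eq ae_eq01_refl)

lemma integrable_signed_powr_mult:
  assumes p: "1 < p" and f: "Lp_function p f" and h: "Lp_function p h"
  shows "integrable lebesgue01 (\<lambda>t. signed_powr (p - 1) (f t) * h t)"
proof (rule Bochner_Integration.integrable_bound)
  show "integrable lebesgue01 (\<lambda>t. \<bar>h t\<bar> powr p + (p - 1) * \<bar>f t\<bar> powr p)"
    using f h by (auto simp: Lp_function_def)
  show "(\<lambda>t. signed_powr (p - 1) (f t) * h t) \<in> borel_measurable lebesgue01"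
    using f h by (auto simp: Lp_function_def signed_powr_def)
  show "AE t in lebesgue01. norm (signed_powr (p - 1) (f t) * h t)
      \<le> norm (\<bar>h t\<bar> powr p + (p - 1) * \<bar>f t\<bar> powr p)"
  proof (rule AE_I2)
    fix t
    show "norm (signed_powr (p - 1) (f t) * h t) \<le> norm (\<bar>h t\<bar> powr p + (p - 1) * \<bar>f t\<bar> powr p)"
      unfolding real_norm_def
      by (rule order_trans[OF signed_powr_mult_le[OF p] abs_ge_self])
  qed
qed

lemma Lp_duality_linear:
  assumes p: "1 < p" and "f \<in> Lp p" "g \<in> Lp p" "h \<in> Lp p"
  shows "Lp_duality p f (g + h) = Lp_duality p f g + Lp_duality p f h"
    and "Lp_duality p f (c *\<^sub>R g) = c * Lp_duality p f g"
proof -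
  obtain u where u: "Lp_function p u" "f = abs_l0 u" using assms Lp_cases by blast
  obtain v where v: "Lp_function p v" "g = abs_l0 v" using assms Lp_cases by blast
  obtain w where w: "Lp_function p w" "h = abs_l0 w" using assms Lp_cases by blast
  have m [measurable]: "u \<in> borel_measurable lebesgue01" "v \<in> borel_measurable lebesgue01"
    "w \<in> borel_measurable lebesgue01"
    using u v w by (auto simp: Lp_function_def)
  note i = integrable_signed_powr_mult[OF p u(1)]
  show "Lp_duality p f (g + h) = Lp_duality p f g + Lp_duality p f h"
    unfolding u v w using i[OF v(1)] i[OF w(1)]
    by (simp add: abs_l0_algebra Lp_duality_abs distrib_left Bochner_Integration.integral_add)
  show "Lp_duality p f (c *\<^sub>R g) = c * Lp_duality p f g"
    unfolding u v using i[OF v(1)]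
    by (simp add: abs_l0_algebra Lp_duality_abs mult.left_commute[of _ c])
qed

lemma Lp_duality_self:
  assumes "0 < p" "f \<in> Lp p"
  shows "Lp_duality p f f = Lp_norm p f powr p"
proof -
  obtain u where u: "Lp_function p u" "f = abs_l0 u" using assms Lp_cases by blast
  then show ?thesis
    using assms by (simp add: Lp_function_def Lp_duality_abs Lp_norm_abs_powr signed_powr_self)
qed

text \<open>
  Every pointwise inequality of this shape can be integrated.  The parameters \<open>A = 0\<close>, \<open>e = 0\<close>,
  \<open>C = 1\<close> give Young's inequality for the pairing, from which its bound by the norm follows; the
  parameters of lemma \<open>dist_powr_le_young_gap\<close> give the strong exposure.
\<close>

lemma Lp_young_gap:
  assumes p: "1 < p" and fh: "f \<in> Lp p" "h \<in> Lp p"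
    and C: "\<And>a b. A * \<bar>a - b\<bar> powr p \<le> e * (\<bar>a\<bar> powr p + \<bar>b\<bar> powr p) + C * young_gap p a b"
  shows "A * Lp_norm p (f - h) powr p \<le> e * (Lp_norm p f powr p + Lp_norm p h powr p)
    + C * (Lp_norm p h powr p + (p - 1) * Lp_norm p f powr p - p * Lp_duality p f h)"
proof -
  obtain u where u: "Lp_function p u" "f = abs_l0 u" using assms Lp_cases by blast
  obtain v where v: "Lp_function p v" "h = abs_l0 v" using assms Lp_cases by blast
  interpret normed_carrier "Lp p" "Lp_norm p"
    using p by unfold_locales (simp add: normed_space_on_Lp)
  have m [measurable]: "u \<in> borel_measurable lebesgue01" "v \<in> borel_measurable lebesgue01"
    using u v by (auto simp: Lp_function_def)
  have iu [simp]: "integrable lebesgue01 (\<lambda>t. \<bar>u t\<bar> powr p)" "integrable lebesgue01 (\<lambda>t. \<bar>v t\<bar> powr p)"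
    using u v by (auto simp: Lp_function_def)
  have id: "integrable lebesgue01 (\<lambda>t. \<bar>u t - v t\<bar> powr p)"
    using carrier_closed(3)[OF fh] unfolding u v abs_l0_algebra(2)[OF m]
    by (subst (asm) abs_l0_in_Lp_iff) (auto simp: Lp_function_def)
  note ip [simp] = integrable_signed_powr_mult[OF p u(1) v(1)]
  have ig: "integrable lebesgue01 (\<lambda>t. young_gap p (u t) (v t))"
    unfolding young_gap_def by simp
  have gap: "(\<integral>t. young_gap p (u t) (v t) \<partial>lebesgue01) =
      Lp_norm p h powr p + (p - 1) * Lp_norm p f powr p - p * Lp_duality p f h"
    unfolding young_gap_def u v using p by (simp add: Lp_norm_abs_powr Lp_duality_abs)
  have "(\<integral>t. A * \<bar>u t - v t\<bar> powr p \<partial>lebesgue01) \<le>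
      (\<integral>t. e * (\<bar>u t\<bar> powr p + \<bar>v t\<bar> powr p) + C * young_gap p (u t) (v t) \<partial>lebesgue01)"
    using id ig C by (intro integral_mono) auto
  also have "\<dots> = e * (Lp_norm p f powr p + Lp_norm p h powr p)
      + C * (\<integral>t. young_gap p (u t) (v t) \<partial>lebesgue01)"
    unfolding u v using ig p by (simp add: Lp_norm_abs_powr)
  finally show ?thesis
    unfolding gap[symmetric] unfolding u v using p by (simp add: abs_l0_algebra Lp_norm_abs_powr)
qed

text \<open>
  For \<open>\<parallel>f\<parallel> = 1\<close>, \<open>\<parallel>h\<parallel> \<le> 1\<close> and pairing at least \<open>1 - \<delta>\<close>, the integrated gap is at most \<open>p \<delta>\<close>, so
  \<open>\<parallel>f - h\<parallel>\<^bsup>p\<^esup>\<close> is at most \<open>2 \<epsilon> + C p \<delta>\<close>.  The choice of \<open>\<delta>\<close> makes this \<open>3 \<epsilon>\<close>.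
\<close>

lemma Lp_strongly_exposed:
  assumes p: "1 < p" and f: "f \<in> Lp p" "Lp_norm p f = 1"
  shows "strongly_exposes (Lp p) (Lp_norm p) (Lp_duality p f) f"
proof -
  interpret normed_carrier "Lp p" "Lp_norm p"
    using p by unfold_locales (simp add: normed_space_on_Lp)
  have scale: "Lp_duality p f (c *\<^sub>R h) = c * Lp_duality p f h" if "h \<in> Lp p" for c h
    using Lp_duality_linear(2)[OF p f(1) that that] .
  \<comment> \<open>Young's inequality becomes Hoelder's by normalising \<open>h\<close>.\<close>
  have le_powr: "p * Lp_duality p f h \<le> Lp_norm p h powr p + (p - 1)" if "h \<in> Lp p" for h
    using Lp_young_gap[OF p f(1) that, of 0 0 1] young_gap_nonneg[OF p] f(2) by simp
  have le: "Lp_duality p f h \<le> Lp_norm p h" if h: "h \<in> Lp p" for h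
  proof (cases "h = 0")
    case True
    then show ?thesis using scale[OF h, of 0] norm_0 by simp
  next
    case False
    let ?g = "inverse (Lp_norm p h) *\<^sub>R h"
    have pos: "0 < Lp_norm p h" using norm_pos h False by blast
    have "p * Lp_duality p f ?g \<le> p"
      using le_powr[of ?g] pos h carrier_closed(4)[OF h] by (simp add: norm_scale)
    then show ?thesis using p pos by (simp add: scale[OF h] field_simps)
  qed
  have abs_le: "\<bar>Lp_duality p f h\<bar> \<le> Lp_norm p h" if h: "h \<in> Lp p" for h
    using le[OF h] le[OF carrier_closed(4)[OF h, of "-1"]] scale[OF h, of "-1"]
      norm_scale[OF h, of "-1"] by simp
  have "\<exists>\<delta>>0. \<forall>h\<in>Lp p. Lp_norm p h \<le> 1 \<longrightarrow> 1 - \<delta> \<le> Lp_duality p f h \<longrightarrow> Lp_norm p (h - f) < e"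
    if e: "0 < e" for e
  proof -
    define \<epsilon> where "\<epsilon> = e powr p / 4"
    have \<epsilon>: "0 < \<epsilon>" using e by (simp add: \<epsilon>_def)
    obtain C where C: "0 < C"
      "\<And>a b. \<bar>a - b\<bar> powr p \<le> \<epsilon> * (\<bar>a\<bar> powr p + \<bar>b\<bar> powr p) + C * young_gap p a b"
      using dist_powr_le_young_gap[OF p \<epsilon>] by metis
    define \<delta> where "\<delta> = \<epsilon> / (C * p)"
    have \<delta>: "0 < \<delta>" using \<epsilon> C p by (simp add: \<delta>_def)
    have "Lp_norm p (h - f) < e"
      if h: "h \<in> Lp p" "Lp_norm p h \<le> 1" "1 - \<delta> \<le> Lp_duality p f h" for h
    proof -
      have h1: "Lp_norm p h powr p \<le> 1"
        using powr_mono2[of p "Lp_norm p h" 1] h p norm_ge_0 by simp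
      have "Lp_norm p (f - h) powr p \<le> \<epsilon> * (1 + Lp_norm p h powr p)
          + C * (Lp_norm p h powr p + (p - 1) - p * Lp_duality p f h)"
        using Lp_young_gap[OF p f(1) h(1), of 1 \<epsilon> C] C(2) f(2) by simp
      also have "\<dots> \<le> \<epsilon> * (1 + 1) + C * (1 + (p - 1) - p * (1 - \<delta>))"
        using h1 h(3) \<epsilon> C(1) p
        by (intro add_mono mult_left_mono diff_mono) auto
      also have "\<dots> = 3 * \<epsilon>" using C(1) p by (simp add: \<delta>_def field_simps)
      also have "\<dots> < e powr p" using \<epsilon> by (simp add: \<epsilon>_def)
      finally have "Lp_norm p (f - h) < e"
        using powr_mono2[of p e "Lp_norm p (f - h)"] e p by force
      then show ?thesis using norm_minus_commute[OF h(1) f(1)] by simp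
    qed
    then show ?thesis using \<delta> by blast
  qed
  moreover have "Lp_duality p f f = 1" using Lp_duality_self[of p f] p f by simp
  ultimately show ?thesis
    unfolding strongly_exposes_def
    using f abs_le scale Lp_duality_linear(1)[OF p f(1)] by blast
qed

section \<open>Separability of \<open>L\<^sub>p\<close>\<close>

context normed_carrier
begin

text \<open>
  The countable dense set consists of the rational linear combinations of \<open>S\<close>.  Its closure \<open>U\<close> is a
  closed subspace, because real coefficients can be approximated by rational ones; the hypothesis
  \<open>total\<close> says that the only closed subspace containing \<open>S\<close> is \<open>V\<close>.
\<close>

lemma separable_on_if_total:
  assumes S: "countable S" "S \<subseteq> V"
    and total: "\<And>U. U \<subseteq> V \<Longrightarrow> subspace U \<Longrightarrow> S \<subseteq> U \<Longrightarrow>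
      (\<And>x. x \<in> V \<Longrightarrow> (\<And>e. 0 < e \<Longrightarrow> \<exists>u\<in>U. N (x - u) < e) \<Longrightarrow> x \<in> U) \<Longrightarrow> V \<subseteq> U"
  shows "separable_on V N"
proof -
  define comb where "comb = (\<lambda>xs. sum_list (map (\<lambda>(q, s::'a). real_of_rat q *\<^sub>R s) xs))"
  define D where "D = comb ` lists (UNIV \<times> S)"
  define U where "U = {x \<in> V. \<forall>e>0. \<exists>d\<in>D. N (x - d) < e}"
  have D_countable: "countable D"
    using S(1) unfolding D_def by (intro countable_image countable_lists) auto
  have comb_V: "comb xs \<in> V" if "xs \<in> lists (UNIV \<times> S)" for xs
    using that
  proof (induction xs)
    case Nil
    then show ?case using carrier_closed(1) by (simp add: comb_def)
  next
    case (Cons y ys)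
    then show ?case using S(2) carrier_closed(2,4) by (force simp: comb_def)
  qed
  then have D_V: "D \<subseteq> V" by (auto simp: D_def)
  have D_add: "x + y \<in> D" if xy: "x \<in> D" "y \<in> D" for x y
  proof -
    obtain xs ys where "xs \<in> lists (UNIV \<times> S)" "x = comb xs" "ys \<in> lists (UNIV \<times> S)" "y = comb ys"
      using xy by (auto simp: D_def)
    then have "xs @ ys \<in> lists (UNIV \<times> S)" "x + y = comb (xs @ ys)"
      by (auto simp: comb_def)
    then show ?thesis unfolding D_def by blast
  qed
  have D_scale: "real_of_rat r *\<^sub>R x \<in> D" if x: "x \<in> D" for r x
  proof -
    obtain xs where xs: "xs \<in> lists (UNIV \<times> S)" "x = comb xs" using x by (auto simp: D_def)
    have "real_of_rat r *\<^sub>R comb xs = comb (map (\<lambda>(q, s). (r * q, s)) xs)"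
      by (induction xs) (auto simp: comb_def scaleR_add_right of_rat_mult)
    moreover have "map (\<lambda>(q, s). (r * q, s)) xs \<in> lists (UNIV \<times> S)" using xs(1) by auto
    ultimately show ?thesis unfolding D_def xs(2) by (metis imageI)
  qed
  have D_0: "0 \<in> D" unfolding D_def by (rule image_eqI[of _ _ "[]"]) (auto simp: comb_def)
  have S_D: "S \<subseteq> D"
  proof
    fix s assume "s \<in> S"
    then show "s \<in> D" unfolding D_def by (intro image_eqI[of _ _ "[(1, s)]"]) (auto simp: comb_def)
  qed
  have U_V: "U \<subseteq> V" by (auto simp: U_def)
  have D_U: "D \<subseteq> U" using D_V norm_0 by (auto simp: U_def intro!: bexI)
  have U_add: "x + y \<in> U" if xy: "x \<in> U" "y \<in> U" for x y
  proof -
    have V: "x \<in> V" "y \<in> V" using xy by (auto simp: U_def)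
    have "\<exists>d\<in>D. N (x + y - d) < e" if e: "0 < e" for e
    proof -
      have "0 < e / 2" using e by simp
      then obtain c d where cd: "c \<in> D" "N (x - c) < e / 2" "d \<in> D" "N (y - d) < e / 2"
        using xy unfolding U_def by blast
      have cdV: "c \<in> V" "d \<in> V" using cd D_V by auto
      have eq: "x + y - (c + d) = (x - c) + (y - d)" by simp
      have "N (x + y - (c + d)) \<le> N (x - c) + N (y - d)"
        unfolding eq
        by (rule norm_triangle[OF carrier_closed(3)[OF V(1) cdV(1)] carrier_closed(3)[OF V(2) cdV(2)]])
      then show ?thesis using cd D_add[OF cd(1,3)] by (intro bexI[of _ "c + d"]) auto
    qed
    then show ?thesis using V carrier_closed(2) by (auto simp: U_def)
  qed
  have U_scale: "c *\<^sub>R x \<in> U" if x: "x \<in> U" for c x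
  proof -
    have V: "x \<in> V" using x by (auto simp: U_def)
    have N0: "0 \<le> N x" using norm_ge_0[OF V] .
    have "\<exists>d\<in>D. N (c *\<^sub>R x - d) < e" if e: "0 < e" for e
    proof -
      define \<eta> where "\<eta> = e / (2 * (N x + 1))"
      have \<eta>: "0 < \<eta>" using e N0 by (simp add: \<eta>_def)
      obtain q where q: "c < real_of_rat q" "real_of_rat q < c + \<eta>"
        using of_rat_dense[of c "c + \<eta>"] \<eta> by auto
      define r where "r = real_of_rat q"
      have r: "\<bar>c - r\<bar> < \<eta>" using q by (simp add: r_def)
      have "0 < e / (2 * (\<bar>r\<bar> + 1))" using e by simp
      then obtain d where d: "d \<in> D" "N (x - d) < e / (2 * (\<bar>r\<bar> + 1))"
        using x unfolding U_def by blast
      have dV: "d \<in> V" using d D_V by auto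
      have "N ((c - r) *\<^sub>R x) \<le> \<eta> * N x"
        using r norm_scale[OF V] N0 by (simp add: mult_right_mono)
      also have "\<dots> < \<eta> * (N x + 1)" using \<eta> by simp
      also have "\<dots> = e / 2" using N0 by (simp add: \<eta>_def field_simps)
      finally have 1: "N ((c - r) *\<^sub>R x) < e / 2" .
      have "N (r *\<^sub>R (x - d)) = \<bar>r\<bar> * N (x - d)"
        using norm_scale[OF carrier_closed(3)[OF V dV]] by simp
      also have "\<dots> \<le> \<bar>r\<bar> * (e / (2 * (\<bar>r\<bar> + 1)))" using d by (intro mult_left_mono) auto
      also have "\<dots> \<le> e / 2" using e by (simp add: field_simps)
      finally have 2: "N (r *\<^sub>R (x - d)) \<le> e / 2" .
      have "c *\<^sub>R x - r *\<^sub>R d = (c - r) *\<^sub>R x + r *\<^sub>R (x - d)" by (simp add: algebra_simps)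
      then have "N (c *\<^sub>R x - r *\<^sub>R d) < e"
        using norm_triangle[OF carrier_closed(4)[OF V] carrier_closed(4)[OF carrier_closed(3)[OF V dV]],
            of "c - r" r] 1 2 by simp
      then show ?thesis using D_scale[OF d(1), of q] unfolding r_def by blast
    qed
    then show ?thesis using V carrier_closed(4) by (auto simp: U_def)
  qed
  have "V \<subseteq> U"
  proof (rule total[OF U_V])
    show "subspace U" unfolding subspace_def using D_0 D_U U_add U_scale by blast
    show "S \<subseteq> U" using S_D D_U by blast
    fix x assume x: "x \<in> V" and approx: "\<And>e. 0 < e \<Longrightarrow> \<exists>u\<in>U. N (x - u) < e"
    have "\<exists>d\<in>D. N (x - d) < e" if e: "0 < e" for e
    proof -
      obtain u where u: "u \<in> U" "N (x - u) < e / 2" using approx[of "e / 2"] e by auto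
      have "0 < e / 2" using e by simp
      then obtain d where d: "d \<in> D" "N (u - d) < e / 2" using u(1) unfolding U_def by blast
      have "u \<in> V" "d \<in> V" using u d U_V D_V by auto
      then show ?thesis using norm_triangle_diff[OF x, of u d] u d by force
    qed
    then show "x \<in> U" using x by (auto simp: U_def)
  qed
  then show ?thesis
    unfolding separable_on_def U_def using D_V D_countable by blast
qed

end

lemma Lp_function_cong_AE:
  assumes "Lp_function p g" "f \<in> borel_measurable lebesgue01" "AE t in lebesgue01. f t = g t"
  shows "Lp_function p f" "abs_l0 f = abs_l0 g"
proof -
  have "ae_eq01 f g" using assms by (auto simp: ae_eq01_def Lp_function_def)
  then show "abs_l0 f = abs_l0 g" by (rule Quotient3_rel_abs[OF Quotient3_l0])
  then show "Lp_function p f"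
    using assms Lp_function_abs abs_l0_in_Lp_iff by metis
qed

text \<open>
  Since \<open>w\<close> also bounds the limit \<open>f\<close>, the functions \<open>\<bar>f - g\<^sub>n\<bar>\<^bsup>p\<^esup>\<close> are dominated by \<open>(2 w)\<^bsup>p\<^esup>\<close>.
\<close>

lemma Lp_dominated_convergence:
  assumes p: "0 < p" and meas [measurable]: "\<And>n. g n \<in> borel_measurable lebesgue01"
      "f \<in> borel_measurable lebesgue01"
    and lim: "\<And>t. (\<lambda>n. g n t) \<longlonglongrightarrow> f t" and bound: "\<And>n t. \<bar>g n t\<bar> \<le> w t"
    and w: "Lp_function p w"
  shows "Lp_function p f"
    and "(\<lambda>n. Lp_norm p (abs_l0 f - abs_l0 (g n))) \<longlonglongrightarrow> 0"
proof -
  have [measurable]: "w \<in> borel_measurable lebesgue01"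
    and iw: "integrable lebesgue01 (\<lambda>t. \<bar>w t\<bar> powr p)" using w by (auto simp: Lp_function_def)
  have f_le: "\<bar>f t\<bar> \<le> w t" for t
    using tendsto_rabs[OF lim[of t]] bound by (intro LIMSEQ_le_const2) auto
  have mono: "\<bar>x\<bar> powr p \<le> \<bar>w t\<bar> powr p" if "\<bar>x\<bar> \<le> w t" for x t
    using that p by (intro powr_mono2) auto
  show "Lp_function p f"
    unfolding Lp_function_def using mono[OF f_le]
    by (intro conjI Bochner_Integration.integrable_bound[OF iw] AE_I2) simp_all
  have "(\<lambda>n. \<integral>t. \<bar>f t - g n t\<bar> powr p \<partial>lebesgue01) \<longlonglongrightarrow> (\<integral>t. 0 \<partial>lebesgue01)"
  proof (rule integral_dominated_convergence)
    show "integrable lebesgue01 (\<lambda>t. 2 powr p * \<bar>w t\<bar> powr p)" using iw by simp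
    show "AE t in lebesgue01. (\<lambda>n. \<bar>f t - g n t\<bar> powr p) \<longlonglongrightarrow> 0"
    proof (rule AE_I2)
      fix t
      have "(\<lambda>n. \<bar>f t - g n t\<bar>) \<longlonglongrightarrow> 0"
        using tendsto_rabs[OF tendsto_diff[OF tendsto_const lim[of t]], of "f t"] by simp
      then have "(\<lambda>n. \<bar>f t - g n t\<bar> powr p) \<longlonglongrightarrow> 0 powr p"
        using p by (intro tendsto_powr') auto
      then show "(\<lambda>n. \<bar>f t - g n t\<bar> powr p) \<longlonglongrightarrow> 0" by simp
    qed
    show "AE t in lebesgue01. norm (\<bar>f t - g n t\<bar> powr p) \<le> 2 powr p * \<bar>w t\<bar> powr p" for n
    proof (rule AE_I2)
      fix t
      have "\<bar>f t - g n t\<bar> \<le> 2 * \<bar>w t\<bar>" using f_le[of t] bound[of n t] by linarith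
      then have "\<bar>f t - g n t\<bar> powr p \<le> (2 * \<bar>w t\<bar>) powr p" using p by (intro powr_mono2) auto
      then show "norm (\<bar>f t - g n t\<bar> powr p) \<le> 2 powr p * \<bar>w t\<bar> powr p" by (simp add: powr_mult)
    qed
  qed auto
  then have "(\<lambda>n. (\<integral>t. \<bar>f t - g n t\<bar> powr p \<partial>lebesgue01) powr (1 / p)) \<longlonglongrightarrow> 0 powr (1 / p)"
    using p by (intro tendsto_powr') (auto intro!: always_eventually Bochner_Integration.integral_nonneg)
  then show "(\<lambda>n. Lp_norm p (abs_l0 f - abs_l0 (g n))) \<longlonglongrightarrow> 0"
    by (simp add: abs_l0_algebra Lp_norm.abs_eq ae_eq01_refl)
qed

lemma borel_imp_measurable_lebesgue01: "f \<in> borel_measurable borel \<Longrightarrow> f \<in> borel_measurable lebesgue01"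
  by (intro measurable_restrict_space1 measurable_completion) simp

lemma finite_measure_lebesgue01: "finite_measure lebesgue01"
  by (intro finite_measureI) (simp add: emeasure_restrict_space)

lemma Lp_function_bounded:
  assumes p: "0 \<le> p" and g: "g \<in> borel_measurable lebesgue01" "\<And>t. \<bar>g t\<bar> \<le> B"
  shows "Lp_function p g"
  unfolding Lp_function_def
proof (intro conjI g(1))
  interpret finite_measure lebesgue01 by (rule finite_measure_lebesgue01)
  show "integrable lebesgue01 (\<lambda>t. \<bar>g t\<bar> powr p)"
    using p g by (intro integrable_const_bound[of _ "B powr p"]) (auto intro!: powr_mono2)
qed

lemma rational_seq_from_above:
  fixes a :: real
  obtains q :: "nat \<Rightarrow> rat" where "\<And>n. a < of_rat (q n)" "(\<lambda>n. real_of_rat (q n)) \<longlonglongrightarrow> a"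
proof -
  have "\<exists>q. a < real_of_rat q \<and> real_of_rat q < a + 1 / real (Suc n)" for n
    using of_rat_dense[of a "a + 1 / real (Suc n)"] by simp
  then obtain q where q: "\<And>n. a < real_of_rat (q n)" "\<And>n. real_of_rat (q n) < a + 1 / real (Suc n)"
    by metis
  have "(\<lambda>n. a + 1 / real (Suc n)) \<longlonglongrightarrow> a"
    using tendsto_add[OF tendsto_const LIMSEQ_Suc[OF lim_1_over_n], of a] by simp
  from tendsto_sandwich[OF _ _ tendsto_const this] have "(\<lambda>n. real_of_rat (q n)) \<longlonglongrightarrow> a"
    using q by (simp add: less_imp_le)
  then show ?thesis using that q by blast
qed

text \<open>
  A closed subspace is stable under dominated limits.  If it contains the indicators of all half-lines
  with rational endpoints, it therefore contains those of all half-lines and, since the Borel sets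
  with indicator in it form a Dynkin system, of all Borel sets.  Linear combinations give the simple
  functions and dominated limits all Borel functions in \<open>L\<^sub>p\<close>, and every Lebesgue measurable function
  agrees with a Borel function almost everywhere.
\<close>

lemma separable_on_Lp:
  assumes p: "1 < p"
  shows "separable_on (Lp p) (Lp_norm p)"
proof -
  interpret normed_carrier "Lp p" "Lp_norm p"
    using p by unfold_locales (simp add: normed_space_on_Lp)
  define S where "S = range (\<lambda>q. abs_l0 (indicator {..real_of_rat q}))"
  have meas_ind: "indicator A \<in> borel_measurable lebesgue01" if "A \<in> sets borel" for A :: "real set"
    using that by (intro borel_imp_measurable_lebesgue01) simp
  have Lp_ind: "Lp_function p (indicator A)" if "A \<in> sets borel" for A
    using p meas_ind[OF that] by (intro Lp_function_bounded[of _ _ 1]) (auto simp: indicator_def)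
  show ?thesis
  proof (rule separable_on_if_total)
    show "countable S" by (simp add: S_def)
    show "S \<subseteq> Lp p" using Lp_ind Lp_function_abs by (auto simp: S_def)
  next
    fix U assume UV: "U \<subseteq> Lp p" and U: "subspace U" and SU: "S \<subseteq> U"
      and closed: "\<And>x. x \<in> Lp p \<Longrightarrow> (\<And>e. 0 < e \<Longrightarrow> \<exists>u\<in>U. Lp_norm p (x - u) < e) \<Longrightarrow> x \<in> U"
    have dominated: "abs_l0 f \<in> U"
      if "\<And>n. abs_l0 (g n) \<in> U" "\<And>n. g n \<in> borel_measurable lebesgue01" "f \<in> borel_measurable lebesgue01"
        "\<And>t. (\<lambda>n. g n t) \<longlonglongrightarrow> f t" "\<And>n t. \<bar>g n t\<bar> \<le> w t" "Lp_function p w"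
      for g :: "nat \<Rightarrow> real \<Rightarrow> real" and f w
    proof (rule closed)
      have p0: "0 < p" using p by simp
      note dc = Lp_dominated_convergence[OF p0 that(2-6)]
      show "abs_l0 f \<in> Lp p" using dc(1) Lp_function_abs by blast
      fix e :: real assume "0 < e"
      with dc(2) obtain n where "Lp_norm p (abs_l0 f - abs_l0 (g n)) < e"
        using eventually_happens'[OF sequentially_bot order_tendstoD(2)] by blast
      then show "\<exists>u\<in>U. Lp_norm p (abs_l0 f - u) < e" using that(1) by blast
    qed
    have lin: "abs_l0 (\<lambda>t. f t + c * g t) \<in> U"
      if "abs_l0 f \<in> U" "abs_l0 g \<in> U" "f \<in> borel_measurable lebesgue01" "g \<in> borel_measurable lebesgue01"
      for f g c
    proof -
      have "abs_l0 f + c *\<^sub>R abs_l0 g \<in> U" using that U by (simp add: subspace_add subspace_scale)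
      then show ?thesis using that(3,4) by (simp add: abs_l0_algebra)
    qed
    have ind_empty: "abs_l0 (indicator {}) \<in> U"
    proof -
      have "indicator {} = (\<lambda>t::real. (0::real) * indicator {..real_of_rat 0} t)" by auto
      then have "abs_l0 (indicator {}) = 0 *\<^sub>R abs_l0 (indicator {..real_of_rat 0})"
        using abs_l0_algebra(3)[OF meas_ind, of "{..real_of_rat 0}" 0] by simp
      then show ?thesis using subspace_0[OF U] by simp
    qed
    have ind_UNIV: "abs_l0 (indicator UNIV) \<in> U"
    proof -
      have "abs_l0 (indicator UNIV) = abs_l0 (indicator {..real_of_rat 1})"
        using p by (intro Lp_function_cong_AE(2)[of p] Lp_ind meas_ind AE_I2) auto
      then show ?thesis using SU by (auto simp: S_def simp del: of_rat_1)
    qed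
    have ind: "abs_l0 (indicator A) \<in> U" if A: "A \<in> sets borel" for A
    proof -
      have borel: "sets borel = sigma_sets UNIV (range (\<lambda>a::real. {..a}))"
        by (subst borel_eq_atMost) (rule sets_measure_of, simp)
      have "Int_stable (range (\<lambda>a::real. {..a}))"
        by (auto simp: Int_stable_def)
      moreover have "range (\<lambda>a::real. {..a}) \<subseteq> Pow UNIV" by simp
      moreover have "A \<in> sigma_sets UNIV (range (\<lambda>a::real. {..a}))" using A borel by simp
      ultimately show ?thesis
      proof (induction rule: sigma_sets_induct_disjoint)
        case (basic A)
        then obtain a where a: "A = {..a}" by auto
        obtain q where q: "\<And>n. a < real_of_rat (q n)" "(\<lambda>n. real_of_rat (q n)) \<longlonglongrightarrow> a"
          using rational_seq_from_above by blast
        show ?case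
        proof (rule dominated)
          show "abs_l0 (indicator {..real_of_rat (q n)}) \<in> U" for n using SU by (auto simp: S_def)
          show "(\<lambda>n. indicator {..real_of_rat (q n)} t) \<longlonglongrightarrow> (indicator A t :: real)" for t
          proof (cases "t \<le> a")
            case True
            then have "indicator {..real_of_rat (q n)} t = (1::real)" for n
              using q(1)[of n] by auto
            then show ?thesis using True a by simp
          next
            case False
            then have "\<forall>\<^sub>F n in sequentially. real_of_rat (q n) < t"
              using order_tendstoD(2)[OF q(2), of t] by simp
            then have "\<forall>\<^sub>F n in sequentially. indicator {..real_of_rat (q n)} t = (0::real)"
              by eventually_elim auto
            then show ?thesis using False a by (simp add: tendsto_eventually)
          qed
          show "Lp_function p (\<lambda>_. 1)" using p by (intro Lp_function_bounded[of _ _ 1]) auto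
        qed (auto simp: a meas_ind)
      next
        case empty
        show ?case by (rule ind_empty)
      next
        case (compl A)
        then have A: "A \<in> sets borel" by (simp add: borel)
        have eq: "indicator (UNIV - A) = (\<lambda>t. indicator UNIV t + (-1::real) * indicator A t)"
          by (auto simp: indicator_def)
        show ?case unfolding eq by (rule lin[OF ind_UNIV compl.IH meas_ind meas_ind]) (use A in auto)
      next
        case (union A)
        then have A: "A i \<in> sets borel" for i by (auto simp: borel)
        show ?case
        proof (rule dominated)
          show "abs_l0 (indicator (\<Union>i<n. A i)) \<in> U" for n
          proof (induction n)
            case 0
            have "(\<Union>i<0::nat. A i) = {}" by simp
            then show ?case using ind_empty by (simp only:)
          next
            case (Suc n)
            have "A n \<inter> A i = {}" if "i < n" for i
              using disjoint_family_onD[OF union(1), of n i] that by simp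
            then have "A n \<inter> (\<Union>i<n. A i) = {}" by blast
            then have eq: "indicator (\<Union>i<Suc n. A i) =
                (\<lambda>t. indicator (\<Union>i<n. A i) t + (1::real) * indicator (A n) t)"
              by (auto simp: indicator_def fun_eq_iff lessThan_Suc)
            show ?case unfolding eq using A by (intro lin Suc union.IH meas_ind) auto
          qed
          show "(\<lambda>n. indicator (\<Union>i<n. A i) t) \<longlonglongrightarrow> (indicator (\<Union>i. A i) t :: real)" for t
            by (rule LIMSEQ_indicator_UN)
          show "Lp_function p (\<lambda>_. 1)" using p by (intro Lp_function_bounded[of _ _ 1]) auto
          show "indicator (\<Union>i<n. A i) \<in> borel_measurable lebesgue01" for n
            using A by (intro meas_ind) auto
          show "indicator (\<Union>i. A i) \<in> borel_measurable lebesgue01"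
            using A by (intro meas_ind) auto
        qed simp
      qed
    qed
    have simple: "abs_l0 s \<in> U" if s: "simple_function borel s" for s :: "real \<Rightarrow> real"
    proof -
      have B: "s -` {y} \<in> sets borel" for y using simple_functionD(2)[OF s, of "{y}"] by simp
      have "(\<lambda>t. \<Sum>y\<in>Y. indicator (s -` {y}) t *\<^sub>R y) \<in> borel_measurable borel" for Y :: "real set"
        using B by simp
      note m = borel_imp_measurable_lebesgue01[OF this]
      have "abs_l0 (\<lambda>t. \<Sum>y\<in>Y. indicator (s -` {y}) t *\<^sub>R y) \<in> U" if "finite Y" for Y
        using that
      proof (induction Y)
        case empty
        have "abs_l0 (indicator {}) = abs_l0 (\<lambda>_. 0)"
          by (rule arg_cong[where f = abs_l0]) auto
        with ind_empty have "abs_l0 (\<lambda>_. 0) \<in> U" by (simp only:)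
        then show ?case by simp
      next
        case (insert y Y)
        have eq: "(\<lambda>t. \<Sum>y\<in>insert y Y. indicator (s -` {y}) t *\<^sub>R y) =
            (\<lambda>t. (\<Sum>y\<in>Y. indicator (s -` {y}) t *\<^sub>R y) + y * indicator (s -` {y}) t)"
          unfolding sum.insert[OF insert.hyps] real_scaleR_def by (simp only: mult.commute add.commute)
        show ?case unfolding eq by (rule lin[OF insert.IH ind[OF B] m meas_ind[OF B]])
      qed
      from this[OF simple_functionD(1)[OF s, unfolded space_borel]]
      have "abs_l0 (\<lambda>t. \<Sum>y\<in>range s. indicator (s -` {y}) t *\<^sub>R y) \<in> U" .
      moreover have "(\<lambda>t. \<Sum>y\<in>range s. indicator (s -` {y}) t *\<^sub>R y) = s"
        by (rule ext, rule simple_function_indicator_representation_banach[OF s,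
            unfolded space_borel Int_UNIV_right, OF UNIV_I, symmetric])
      ultimately show ?thesis by (simp only:)
    qed
    show "Lp p \<subseteq> U"
    proof
      fix x assume "x \<in> Lp p"
      then obtain f where f: "Lp_function p f" "x = abs_l0 f" by (rule Lp_cases)
      let ?f0 = "\<lambda>t. if t \<in> {0..1} then f t else 0"
      have "?f0 \<in> borel_measurable lebesgue"
        using f by (intro borel_measurable_if_I) (auto simp: Lp_function_def)
      then obtain h where h: "h \<in> borel_measurable borel" "AE t in lborel. ?f0 t = h t"
        using completion_ex_borel_measurable_real[of ?f0 lborel] by auto
      have "AE t in lebesgue01. h t = f t"
        using AE_completion[OF h(2)] by (auto simp: AE_restrict_space_iff elim: eventually_mono)
      note h_Lp = Lp_function_cong_AE[OF f(1) borel_imp_measurable_lebesgue01[OF h(1)] this]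
      obtain s where s: "\<And>n. simple_function borel (s n)" "\<And>t. (\<lambda>n. s n t) \<longlonglongrightarrow> h t"
          "\<And>n t. \<bar>s n t\<bar> \<le> 2 * \<bar>h t\<bar>"
        using borel_measurable_implies_sequence_metric[OF h(1), of 0] by (auto simp: dist_norm)
      have "Lp_function p (\<lambda>t. 2 * \<bar>h t\<bar>)"
        using h_Lp(1) by (auto simp: Lp_function_def powr_mult abs_mult)
      then have "abs_l0 h \<in> U"
        using dominated[OF simple[OF s(1)]
            borel_imp_measurable_lebesgue01[OF borel_measurable_simple_function[OF s(1)]]
            borel_imp_measurable_lebesgue01[OF h(1)] s(2,3)] by blast
      then show "x \<in> U" using h_Lp(2) f(2) by simp
    qed
  qed
qed

lemma Lp_nontrivial:
  assumes p: "1 < p"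
  shows "Lp p \<noteq> {0}"
proof -
  interpret normed_carrier "Lp p" "Lp_norm p"
    using p by unfold_locales (simp add: normed_space_on_Lp)
  have one: "Lp_function p (\<lambda>_. 1)" using p by (intro Lp_function_bounded[of _ _ 1]) auto
  have "Lp_norm p (abs_l0 (\<lambda>_. 1)) powr p = 1"
    using p by (simp add: Lp_norm_abs_powr measure_restrict_space)
  then have "abs_l0 (\<lambda>_. 1) \<noteq> 0" using norm_0 p by auto
  then show ?thesis using Lp_function_abs[OF one] by blast
qed

theorem corollary3p13:
  fixes p :: real
  assumes "1 < p"
  shows "ball_covering_property (Lp_operators p) (Lp_operator_norm p)"
proof -
  interpret normed_carrier_pair "Lp p" "Lp_norm p" "Lp p" "Lp_norm p"
    using assms by unfold_locales (simp_all add: normed_space_on_Lp)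
  show ?thesis
    unfolding Lp_operators_def Lp_operator_norm_def
    using separable_on_Lp[OF assms] Lp_nontrivial[OF assms] Lp_strongly_exposed[OF assms]
    by (intro ball_covering_property_bounded_operators) blast+
qed

end
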